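(* Consider the normalized attention dynamics $$\dot\theta_j(t)=\frac{1}{s_j(t)}\,\mathbf P_{\theta_j(t)}A_j(\Theta(t)),\qquad j=1,\dots,n,$$ on $(\mathbb S^{d-1})^n$ with $V=I_d$ and arbitrary $Q,K$ such that $\|Q^\top K\|\le1$, under one of the six normalization schemes defined in the context, initialized at $\theta_1(0),\dots,\theta_n(0)$ in a local cone, namely $\langle\theta_j(0),\theta_k(0)\rangle\ge1-\delta$ for $\delta<1/(100n^2\beta^2)$. Let the cluster center be $\bar\theta(t)=\frac1n\sum_{j=1}^n\theta_j(t)$ and let $\mathrm{Var}(t)=\frac1n\sum_{k=1}^n\|\theta_k(t)-\bar\theta(t)\|^2$. Then the following properties hold: (i) (Radial growth) For all $k$, the radial component satisfies $$r_k(t)\ge(1-\delta)t\quad\text{for both Pre-LN and Peri-LN}.$$ (ii) (Speed of clustering) It holds $$\frac{d}{dt}\mathrm{Var}(t)=\begin{cases}-\Theta(\mathrm{Var}(t)) & \text{for Post-LN},\\ -\Theta(\mathrm{Var}(t)/t) & \text{for Pre-LN},\\ -\Theta(\mathrm{Var}(t)/t) & \text{for Peri-LN},\\ -\Theta(\mathrm{Var}(t)/\alpha_t) & \text{for nGPT},\\ -\Theta(\mathrm{Var}(t)/t) & \text{for Mix-LN},\\ -\Theta(\mathrm{Var}(t)/\sqrt t) & \text{for sqrt-scaling}.\end{cases}$$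
   Context: Notation: $\mathbb S^{d-1}$ is the unit sphere of $\mathbb R^d$; $\Theta(t)=[\theta_1(t),\dots,\theta_n(t)]$ with $\theta_j\in\mathbb S^{d-1}$ (not to be confused with the order symbol $\Theta(\cdot)$ in (ii), which as usual denotes a quantity bounded above and below by positive constant multiples of its argument); $\mathbf P_\theta=I_d-\theta\theta^\top$; $\beta$ is a fixed temperature parameter; $Q,K\in\mathbb R^{d\times d}$ and $\|Q^\top K\|$ is the operator norm. With $V=I_d$ the attention vector is $$A_j(\Theta)=\sum_{k=1}^n\frac{e^{\beta\langle Q\theta_j,K\theta_k\rangle}}{\sum_{l=1}^n e^{\beta\langle Q\theta_j,K\theta_l\rangle}}\theta_k.$$ Each token has a direction $\theta_j(t)$ and a magnitude (radial component) $r_j(t)\ge0$. The six schemes are specified by $s_j(t)$ and $\dot r_j(t)$, with $A_j=A_j(\Theta(t))$: - Post-LN: $s_j=1$, $\dot r_j=0$. - Pre-LN: $s_j=r_j(t)$, $\dot r_j=\langle\theta_j(t),A_j\rangle$. - Mix-LN (with a fixed switching time $\tau$): $s_j=\mathbf 1_{t\le\tau}+r_j(t)\mathbf 1_{t>\tau}$, $\dot r_j=\langle\theta_j(t),A_j\rangle\mathbf 1_{t>\tau}$. - Peri-LN: $s_j=r_j(t)\|A_j\|$, $\dot r_j=\langle\theta_j(t),A_j\rangle/\|A_j\|$. - nGPT (where $\alpha_t\in\mathbb R$ is a layer-dependent, i.e. $t$-dependent, learnable parameter): $s_j=\alpha_t^{-1}\|A_j\|$, $\dot r_j=0$. - sqrt-scaling: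 $s_j=\sqrt{t+1}$, $\dot r_j=0$.
   Formalization: Adds δ<1 (else antipodal tokens are stationary for small β); for nGPT the rate Var/α_t is proved for 0<a≤α_t≤b (false for unbounded α), and rate α_t·Var for all α_t>0; rates in Var/t hold for all large t, Var/√t for t≥1. *)

theory Defs
  imports "HOL-Analysis.Analysis"
begin

definition tangent_proj :: "real^'d \<Rightarrow> real^'d^'d" where
  "tangent_proj \<theta> = mat 1 - (\<chi> i j. \<theta> $ i * \<theta> $ j)"

definition attention :: "real \<Rightarrow> real^'d^'d \<Rightarrow> real^'d^'d \<Rightarrow> ('n::finite \<Rightarrow> real^'d) \<Rightarrow> 'n \<Rightarrow> real^'d" where
  "attention \<beta> Q K \<Theta> j =
     (\<Sum>k\<in>UNIV. (exp (\<beta> * ((Q *v \<Theta> j) \<bullet> (K *v \<Theta> k)))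
                  / (\<Sum>l\<in>UNIV. exp (\<beta> * ((Q *v \<Theta> j) \<bullet> (K *v \<Theta> l))))) *\<^sub>R \<Theta> k)"

text \<open>The argument of \<open>Mix_LN\<close> is the switching time, that of \<open>NGPT\<close> the function
  \<open>t \<mapsto> \<alpha>\<^sub>t\<close>.\<close>

datatype scheme =
  Post_LN | Pre_LN | Mix_LN real | Peri_LN | NGPT "real \<Rightarrow> real" | Sqrt_Scaling

text \<open>\<open>speed S t r A\<close> is \<open>s\<^sub>j(t)\<close> and \<open>radial_rate S t \<theta> A\<close> is the prescribed derivative of
  \<open>r\<^sub>j\<close> at \<open>t\<close>, for \<open>r = r\<^sub>j(t)\<close>, \<open>\<theta> = \<theta>\<^sub>j(t)\<close> and \<open>A = A\<^sub>j(\<Theta>(t))\<close>.\<close>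

fun speed :: "scheme \<Rightarrow> real \<Rightarrow> real \<Rightarrow> real^'d \<Rightarrow> real" where
  "speed Post_LN t r A = 1"
| "speed Pre_LN t r A = r"
| "speed (Mix_LN \<tau>) t r A = indicator {..\<tau>} t + r * indicator {\<tau><..} t"
| "speed Peri_LN t r A = r * norm A"
| "speed (NGPT \<alpha>) t r A = inverse (\<alpha> t) * norm A"
| "speed Sqrt_Scaling t r A = sqrt (t + 1)"

fun radial_rate :: "scheme \<Rightarrow> real \<Rightarrow> real^'d \<Rightarrow> real^'d \<Rightarrow> real" where
  "radial_rate Post_LN t \<theta> A = 0"
| "radial_rate Pre_LN t \<theta> A = \<theta> \<bullet> A"
| "radial_rate (Mix_LN \<tau>) t \<theta> A = (\<theta> \<bullet> A) * indicator {\<tau><..} t"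
| "radial_rate Peri_LN t \<theta> A = (\<theta> \<bullet> A) / norm A"
| "radial_rate (NGPT \<alpha>) t \<theta> A = 0"
| "radial_rate Sqrt_Scaling t \<theta> A = 0"

text \<open>The right-hand side of Mix-LN jumps at the switching time, so that a solution is
  continuous there but in general not differentiable.\<close>

fun switching_times :: "scheme \<Rightarrow> real set" where
  "switching_times (Mix_LN \<tau>) = {\<tau>}"
| "switching_times _ = {}"

text \<open>Solutions on \<open>[0,\<infinity>)\<close>: the initial value is attained continuously and the equations
  hold for \<open>t > 0\<close>, so that nothing is asked at \<open>t = 0\<close>, where \<open>s\<^sub>j\<close> vanishes if
  \<open>r\<^sub>j(0) = 0\<close>.\<close>

definition attention_flow ::
  "real \<Rightarrow> real^'d^'d \<Rightarrow> real^'d^'d \<Rightarrow> scheme \<Rightarrow> (real \<Rightarrow> 'n::finite \<Rightarrow> real^'d) \<Rightarrow> (real \<Rightarrow> 'n \<Rightarrow> real) \<Rightarrow> bool"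
where
  "attention_flow \<beta> Q K S \<Theta> r \<longleftrightarrow>
     (\<forall>j. continuous_on {0..} (\<lambda>t. \<Theta> t j) \<and> continuous_on {0..} (\<lambda>t. r t j)) \<and>
     (\<forall>t\<ge>0. \<forall>j. \<Theta> t j \<in> sphere 0 1 \<and> r t j \<ge> 0) \<and>
     (\<forall>t>0. t \<notin> switching_times S \<longrightarrow> (\<forall>j.
        ((\<lambda>u. \<Theta> u j) has_vector_derivative
           (1 / speed S t (r t j) (attention \<beta> Q K (\<Theta> t) j)) *\<^sub>R
             (tangent_proj (\<Theta> t j) *v attention \<beta> Q K (\<Theta> t) j)) (at t) \<and>
        ((\<lambda>u. r u j) has_real_derivative
           radial_rate S t (\<Theta> t j) (attention \<beta> Q K (\<Theta> t) j)) (at t)))"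

definition in_cone :: "real \<Rightarrow> ('n \<Rightarrow> real^'d) \<Rightarrow> bool" where
  "in_cone \<delta> \<Theta> \<longleftrightarrow> (\<forall>j k. \<Theta> j \<bullet> \<Theta> k \<ge> 1 - \<delta>)"

definition cone_flow ::
  "real \<Rightarrow> real^'d^'d \<Rightarrow> real^'d^'d \<Rightarrow> real \<Rightarrow> scheme \<Rightarrow> (real \<Rightarrow> 'n::finite \<Rightarrow> real^'d) \<Rightarrow> (real \<Rightarrow> 'n \<Rightarrow> real) \<Rightarrow> bool"
where
  "cone_flow \<beta> Q K \<delta> S \<Theta> r \<longleftrightarrow> attention_flow \<beta> Q K S \<Theta> r \<and> in_cone \<delta> (\<Theta> 0)"

definition center :: "('n::finite \<Rightarrow> real^'d) \<Rightarrow> real^'d" where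
  "center \<Theta> = (1 / real CARD('n)) *\<^sub>R (\<Sum>j\<in>UNIV. \<Theta> j)"

definition Var :: "('n::finite \<Rightarrow> real^'d) \<Rightarrow> real" where
  "Var \<Theta> = (1 / real CARD('n)) * (\<Sum>k\<in>UNIV. (norm (\<Theta> k - center \<Theta>))\<^sup>2)"

text \<open>\<open>d/dt Var(t) = -\<Theta>(x)\<close> at the time \<open>t\<close>, with constants \<open>c\<close> and \<open>C\<close>; the quantifiers over
  \<open>c\<close>, \<open>C\<close> and \<open>t\<close> are left to the user of the definition. The library's Landau symbol
  is not used because it would lose the sign.\<close>

definition Var_decay :: "real \<Rightarrow> real \<Rightarrow> (real \<Rightarrow> 'n::finite \<Rightarrow> real^'d) \<Rightarrow> real \<Rightarrow> real \<Rightarrow> bool" where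
  "Var_decay c C \<Theta> t x \<longleftrightarrow>
     (\<exists>D. ((\<lambda>u. Var (\<Theta> u)) has_real_derivative D) (at t) \<and> c * x \<le> - D \<and> - D \<le> C * x)"

end

theory Submission
  imports Defs
begin

text \<open>With \<open>p\<^sub>j = P\<^bsub>\<theta>\<^sub>j\<^esub> center\<close> one has \<open>Var = 1 - \<parallel>center\<parallel>\<^sup>2\<close> and
  \<open>Var' = -(2/n) \<Sum>\<^sub>j A\<^sub>j \<bullet> p\<^sub>j / s\<^sub>j\<close>. For uniform attention weights \<open>A\<^sub>j \<bullet> p\<^sub>j = \<parallel>p\<^sub>j\<parallel>\<^sup>2\<close>, and
  \<open>M = \<Sum>\<^sub>j \<parallel>p\<^sub>j\<parallel>\<^sup>2\<close> is comparable with \<open>Var\<close>. In the cone the softmax weights are so close to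
  uniform that the correction is at most a fraction of \<open>M\<close>, and the resulting bounds persist when
  the speeds \<open>s\<^sub>j\<close> agree up to a factor of two.

  The cone is invariant because the smallest pairwise inner product cannot decrease, whatever the
  nonnegative speeds. For the schemes with radial growth the speeds are at most of order \<open>t\<close>, so
  \<open>\<integral> dt/s\<^sub>j\<close> diverges and the smallest inner product tends to 1; then \<open>\<theta>\<^sub>j \<bullet> A\<^sub>j\<close> tends to 1 and
  the speeds become comparable with \<open>t\<close> and with each other, even if \<open>\<delta>\<close> is close to 1.\<close>

section \<open>Tangential projection, a barrier argument, variance of unit vectors\<close>

lemma tangent_proj_mult: "tangent_proj \<theta> *v v = v - (\<theta> \<bullet> v) *\<^sub>R \<theta>"
proof -
  have "(\<chi> i j. \<theta> $ i * \<theta> $ j) *v v = (\<theta> \<bullet> v) *\<^sub>R \<theta>"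
    by (simp add: vec_eq_iff matrix_vector_mult_def inner_vec_def sum_distrib_left mult_ac)
  then show ?thesis
    by (simp add: tangent_proj_def matrix_vector_mult_diff_rdistrib)
qed

text \<open>At the first time some member of the family reaches 0, all members are nonnegative, so
  its derivative is positive and it would have been negative just before. Derivatives enter only at
  interior times, so the interval may begin or end where the equations fail.\<close>

lemma finite_barrier:
  fixes f :: "'p::finite \<Rightarrow> real \<Rightarrow> real"
  assumes cont: "\<And>p. continuous_on {a..b} (f p)"
    and init: "\<And>p. f p a > 0"
    and deriv: "\<And>t p. a < t \<Longrightarrow> t < b \<Longrightarrow> \<forall>q. f q t \<ge> 0 \<Longrightarrow> f p t = 0 \<Longrightarrow>
      \<exists>D>0. (f p has_real_derivative D) (at t)"
    and t: "a \<le> t" "t \<le> b"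
  shows "f p t \<ge> 0"
proof (rule ccontr)
  assume "\<not> f p t \<ge> 0"
  then have neg: "f p t < 0" by simp
  \<comment> \<open>Finiteness of the index type makes this set of times compact, so it has a least
    element.\<close>
  define S where "S = (\<Union>q. {s\<in>{a..t}. f q s \<le> 0})"
  have "compact {s\<in>{a..t}. f q s \<le> 0}" for q
  proof -
    have "closed {s\<in>{a..t}. f q s \<le> 0}"
      by (rule continuous_on_closed_Collect_le)
        (use t in \<open>auto intro!: continuous_on_subset[OF cont]\<close>)
    then show ?thesis
      using compact_Int_closed[OF compact_Icc[of a t], of "{s\<in>{a..t}. f q s \<le> 0}"]
      by (simp add: Int_absorb1 subset_eq)
  qed
  then have "compact S"
    unfolding S_def by (intro compact_UN) auto
  moreover have "t \<in> S"
    using neg t by (auto simp: S_def intro!: exI[of _ p])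
  ultimately obtain t0 where t0: "t0 \<in> S" "\<And>s. s \<in> S \<Longrightarrow> t0 \<le> s"
    using compact_attains_inf by (metis empty_iff)
  obtain q where q: "f q t0 \<le> 0" "a \<le> t0" "t0 \<le> t"
    using t0(1) by (auto simp: S_def)
  have "a < t0"
    using q init[of q] by (cases "a = t0") auto
  have before: "f q' s > 0" if "a \<le> s" "s < t0" for q' s
  proof (rule ccontr)
    assume "\<not> f q' s > 0"
    then have "s \<in> S" using that q(3) by (auto simp: S_def not_less intro!: exI[of _ q'])
    then show False using t0(2)[of s] that by simp
  qed
  have nonneg: "f q' t0 \<ge> 0" for q'
  proof (rule tendsto_lowerbound)
    have "continuous_on {a..t0} (f q')"
      by (rule continuous_on_subset[OF cont]) (use q t in auto)
    then show "(f q' \<longlongrightarrow> f q' t0) (at_left t0)"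
      using \<open>a < t0\<close> continuous_on_Icc_at_leftD by blast
    show "\<forall>\<^sub>F s in at_left t0. 0 \<le> f q' s"
      unfolding eventually_at_left[OF \<open>a < t0\<close>]
      using before \<open>a < t0\<close> by (intro exI[of _ a]) (auto intro: less_imp_le)
  qed auto
  have "f q t0 = 0" using q nonneg[of q] by simp
  \<comment> \<open>\<open>f p\<close> is negative at \<open>t\<close> but not at \<open>t0\<close>,
    so \<open>t0\<close> comes strictly before \<open>t\<close>.\<close>
  moreover have "t0 < b"
    using q t neg nonneg[of p] by (cases "t0 = t") auto
  ultimately obtain D where D: "D > 0" "(f q has_real_derivative D) (at t0)"
    using deriv nonneg \<open>a < t0\<close> by blast
  obtain d where d: "d > 0" "\<And>h. 0 < h \<Longrightarrow> h < d \<Longrightarrow> f q (t0 - h) < f q t0"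
    using DERIV_pos_inc_left[OF D(2) D(1)] by blast
  define h where "h = min (d / 2) (t0 - a)"
  have "0 < h" "h < d" "a \<le> t0 - h" "t0 - h < t0"
    using d \<open>a < t0\<close> by (auto simp: h_def)
  then show False
    using d(2)[of h] before[of "t0 - h" q] \<open>f q t0 = 0\<close> by simp
qed

lemma sum_inner_center:
  fixes \<theta> :: "'n::finite \<Rightarrow> real^'d"
  shows "(\<Sum>j\<in>UNIV. \<theta> j \<bullet> x) = real CARD('n) * (center \<theta> \<bullet> x)"
    and "(\<Sum>j\<in>UNIV. x \<bullet> \<theta> j) = real CARD('n) * (x \<bullet> center \<theta>)"
  by (simp_all add: center_def inner_sum_left inner_sum_right)

lemma Var_nonneg: "Var \<theta> \<ge> 0"
  by (simp add: Var_def sum_nonneg)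

lemma Var_unit:
  fixes \<theta> :: "'n::finite \<Rightarrow> real^'d"
  assumes "\<And>j. norm (\<theta> j) = 1"
  shows "Var \<theta> = 1 - (norm (center \<theta>))\<^sup>2"
proof -
  have "(norm (\<theta> k - center \<theta>))\<^sup>2 = 1 + (norm (center \<theta>))\<^sup>2 - 2 * (\<theta> k \<bullet> center \<theta>)" for k
    using assms[of k] by (simp add: power2_norm_eq_inner inner_diff inner_commute norm_eq_1)
  then have "(\<Sum>k\<in>UNIV. (norm (\<theta> k - center \<theta>))\<^sup>2)
      = real CARD('n) * (1 - (norm (center \<theta>))\<^sup>2)"
    by (simp add: sum.distrib sum_subtractf sum_inner_center flip: sum_distrib_left)
      (simp add: power2_norm_eq_inner algebra_simps)
  then show ?thesis
    by (simp add: Var_def)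
qed

section \<open>Dissipation for nearly uniform attention weights\<close>

text \<open>The total deviation of a row of weights from uniform is at most \<open>0.18/n\<close>. This suffices
  because nonnegative inner products force \<open>\<parallel>center\<parallel> \<ge> 1/\<surd>n\<close>, whatever the width of the cone.\<close>

locale near_uniform_attention =
  fixes \<theta> :: "'n::finite \<Rightarrow> real^'d" and a :: "'n \<Rightarrow> 'n \<Rightarrow> real" and n :: real
  assumes unit: "norm (\<theta> j) = 1"
    and inner_nonneg: "\<theta> j \<bullet> \<theta> k \<ge> 0"
    and sum_weights: "(\<Sum>k\<in>UNIV. a j k) = 1"
    and weights_near: "\<bar>a j k - 1 / n\<bar> \<le> (18/100) / n\<^sup>2"
    and card_n: "real CARD('n) = n"
begin

declare card_n [simp]

abbreviation "\<rho> \<equiv> norm (center \<theta>)"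
definition "A j = (\<Sum>k\<in>UNIV. a j k *\<^sub>R \<theta> k)"
definition "p j = center \<theta> - (\<theta> j \<bullet> center \<theta>) *\<^sub>R \<theta> j"
definition "M = (\<Sum>j\<in>UNIV. (norm (p j))\<^sup>2)"

lemma n_ge_1: "n \<ge> 1"
  by (simp add: Suc_leI flip: card_n)

lemma inner_self: "\<theta> j \<bullet> \<theta> j = 1"
  using unit by (simp add: norm_eq_1)

text \<open>The deviation is below half of 1/n. The bound is later what makes the growth of the
  smallest inner product quantitative.\<close>

lemma weight_lower: "a j k \<ge> 1 / (2 * n)"
proof -
  have "(18/100) / n\<^sup>2 \<le> (1/2) / n"
    using n_ge_1 by (simp add: power2_eq_square divide_simps)
  then show ?thesis
    using weights_near[of j k] by (simp add: abs_le_iff field_simps)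
qed

lemma weight_nonneg: "a j k \<ge> 0"
  using weight_lower[of j k] n_ge_1 by (meson divide_nonneg_nonneg order_trans zero_le_numeral mult_nonneg_nonneg of_nat_0_le_iff zero_le_one)

lemma norm_A_le: "norm (A j) \<le> 1"
proof -
  have "norm (A j) \<le> (\<Sum>k\<in>UNIV. norm (a j k *\<^sub>R \<theta> k))"
    unfolding A_def by (rule norm_sum)
  also have "\<dots> = 1"
    using sum_weights weight_nonneg by (simp add: unit)
  finally show ?thesis .
qed

text \<open>The sum of all pairwise inner products is n^2 \<rho>^2. Its diagonal contributes n and
  its other terms are nonnegative.\<close>

lemma center_lower: "n * \<rho>\<^sup>2 \<ge> 1"
proof -
  have "n = (\<Sum>j\<in>UNIV. \<theta> j \<bullet> \<theta> j)"
    by (simp add: inner_self)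
  also have "\<dots> \<le> (\<Sum>j\<in>UNIV. \<Sum>k\<in>UNIV. \<theta> k \<bullet> \<theta> j)"
    by (intro sum_mono member_le_sum) (auto simp: inner_nonneg)
  also have "\<dots> = (\<Sum>j\<in>UNIV. n * (center \<theta> \<bullet> \<theta> j))"
    by (simp add: sum_inner_center(1))
  also have "\<dots> = n * (n * \<rho>\<^sup>2)"
    by (simp add: sum_inner_center power2_norm_eq_inner flip: sum_distrib_left)
  finally show ?thesis using n_ge_1 by simp
qed

lemma center_le: "\<rho> \<le> 1"
proof -
  have "\<rho>\<^sup>2 \<le> 1" using Var_nonneg[of \<theta>] by (simp add: Var_unit unit)
  then show ?thesis by (simp add: power_le_one_iff abs_square_le_1)
qed

text \<open>Follows from \<open>center_lower\<close> because \<rho>^2 \<le> \<rho>. This form turns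
  an absolute error of order 1/n into one relative to \<rho>.\<close>

lemma center_ge: "\<rho> \<ge> 1 / n"
proof -
  have "1 \<le> n * \<rho>\<^sup>2" by (rule center_lower)
  also have "\<dots> \<le> n * \<rho>"
    using center_le n_ge_1 by (simp add: power2_eq_square mult_left_le)
  finally show ?thesis using n_ge_1 by (simp add: field_simps)
qed

lemma A_near_center: "norm (A j - center \<theta>) \<le> (18/100) * \<rho>"
proof -
  have "A j - center \<theta> = (\<Sum>k\<in>UNIV. (a j k - 1 / n) *\<^sub>R \<theta> k)"
    by (simp add: A_def center_def scaleR_diff_left sum_subtractf scaleR_sum_right)
  then have "norm (A j - center \<theta>) \<le> (\<Sum>k\<in>UNIV. norm ((a j k - 1 / n) *\<^sub>R \<theta> k))"
    by (metis norm_sum)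
  also have "\<dots> \<le> (\<Sum>k\<in>(UNIV::'n set). (18/100) / n\<^sup>2)"
    using weights_near by (intro sum_mono) (simp add: unit)
  also have "\<dots> = (18/100) * (1 / n)"
    by (simp add: power2_eq_square)
  also have "\<dots> \<le> (18/100) * \<rho>"
    using center_ge by (intro mult_left_mono) auto
  finally show ?thesis .
qed

text \<open>Since 118/82 < 2, the rates of nGPT, which are inversely proportional to these norms,
  agree up to the factor allowed in \<open>dissipation\<close>.\<close>

lemma norm_A_bounds: "82/100 * \<rho> \<le> norm (A j)" "norm (A j) \<le> 118/100 * \<rho>"
  using A_near_center[of j] norm_triangle_ineq3[of "A j" "center \<theta>"] by auto

section \<open>Tangential parts of the center and their comparison with the variance\<close>

lemma inner_p: "\<theta> j \<bullet> p j = 0" "center \<theta> \<bullet> p j = (norm (p j))\<^sup>2"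
  "(norm (p j))\<^sup>2 = \<rho>\<^sup>2 - (\<theta> j \<bullet> center \<theta>)\<^sup>2"
  by (simp_all add: p_def power2_norm_eq_inner inner_diff inner_self)
    (simp_all add: inner_commute power2_eq_square algebra_simps)

text \<open>As \<theta>_j \<bullet> center lies in [0, \<rho>], its square is at most \<rho> times
  itself. Averaging then gives M \<ge> n \<rho>^2 (1 - \<rho>) \<ge> 1 - \<rho>, while Var = (1 -
  \<rho>)(1 + \<rho>) \<le> 2 (1 - \<rho>).\<close>

lemma M_lower: "M \<ge> Var \<theta> / 2"
proof -
  have "(\<theta> j \<bullet> center \<theta>)\<^sup>2 \<le> \<rho> * (\<theta> j \<bullet> center \<theta>)" for j
  proof -
    have "\<theta> j \<bullet> center \<theta> \<ge> 0"
      using n_ge_1 by (simp add: center_def inner_sum_right sum_nonneg inner_nonneg)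
    moreover have "\<theta> j \<bullet> center \<theta> \<le> \<rho>"
      using norm_cauchy_schwarz[of "\<theta> j" "center \<theta>"] by (simp add: unit)
    ultimately show ?thesis by (simp add: power2_eq_square mult_right_mono)
  qed
  then have "(\<Sum>j\<in>UNIV. \<rho>\<^sup>2 - \<rho> * (\<theta> j \<bullet> center \<theta>)) \<le> M"
    unfolding M_def inner_p(3) by (intro sum_mono) auto
  moreover have "(\<Sum>j\<in>UNIV. \<rho>\<^sup>2 - \<rho> * (\<theta> j \<bullet> center \<theta>)) = n * \<rho>\<^sup>2 * (1 - \<rho>)"
    by (simp add: sum_subtractf sum_inner_center flip: sum_distrib_left)
      (simp add: power2_eq_square algebra_simps flip: power2_norm_eq_inner)
  ultimately have "n * \<rho>\<^sup>2 * (1 - \<rho>) \<le> M" by simp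
  moreover have "1 * (1 - \<rho>) \<le> n * \<rho>\<^sup>2 * (1 - \<rho>)"
    using center_lower center_le by (intro mult_right_mono) auto
  moreover have "Var \<theta> \<le> 2 * (1 - \<rho>)"
  proof -
    have "0 \<le> (1 - \<rho>)\<^sup>2" by simp
    then show ?thesis by (simp add: Var_unit unit power2_eq_square algebra_simps)
  qed
  ultimately show ?thesis by simp
qed

text \<open>The norm of \<open>p j\<close> is the distance from the center to the line through
  \<theta>_j, hence at most its distance to \<theta>_j itself.\<close>

lemma M_upper: "M \<le> n * Var \<theta>"
proof -
  have "(norm (p j))\<^sup>2 \<le> (norm (\<theta> j - center \<theta>))\<^sup>2" for j
  proof -
    have "0 \<le> (1 - \<theta> j \<bullet> center \<theta>)\<^sup>2" by simp
    moreover have e: "(norm (\<theta> j - center \<theta>))\<^sup>2 = 1 + \<rho>\<^sup>2 - 2 * (\<theta> j \<bullet> center \<theta>)"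
      by (simp add: power2_norm_eq_inner inner_diff inner_self inner_commute)
    ultimately show ?thesis
      unfolding inner_p(3) e by (simp add: power2_diff)
  qed
  then have "M \<le> (\<Sum>j\<in>UNIV. (norm (\<theta> j - center \<theta>))\<^sup>2)"
    unfolding M_def by (rule sum_mono)
  then show ?thesis using n_ge_1 by (simp add: Var_def)
qed

definition "err j = (18/100) / n\<^sup>2 * (\<Sum>k\<in>UNIV. norm (p j) * norm (\<theta> k - \<theta> j))"

text \<open>As \<open>p j\<close> is orthogonal to \<theta>_j, each \<theta>_k in the error may be
  replaced by \<theta>_k - \<theta>_j. The error thus becomes quadratic in the spread of the tokens,
  like M.\<close>

lemma drift_near: "\<bar>A j \<bullet> p j - (norm (p j))\<^sup>2\<bar> \<le> err j"
proof -
  have "A j \<bullet> p j - (norm (p j))\<^sup>2 = (A j - center \<theta>) \<bullet> p j"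
    by (simp add: inner_diff_left inner_p)
  also have "\<dots> = (\<Sum>k\<in>UNIV. (a j k - 1 / n) * (\<theta> k \<bullet> p j))"
    by (simp add: A_def center_def left_diff_distrib sum_subtractf inner_diff_left
        inner_sum_left sum_divide_distrib)
  also have "\<bar>\<dots>\<bar> \<le> (\<Sum>k\<in>UNIV. \<bar>(a j k - 1 / n) * (\<theta> k \<bullet> p j)\<bar>)"
    by (rule sum_abs)
  also have "\<dots> \<le> (\<Sum>k\<in>UNIV. (18/100) / n\<^sup>2 * (norm (p j) * norm (\<theta> k - \<theta> j)))"
  proof (intro sum_mono)
    fix k
    have "\<bar>\<theta> k \<bullet> p j\<bar> = \<bar>(\<theta> k - \<theta> j) \<bullet> p j\<bar>"
      by (simp add: inner_diff_left inner_p)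
    also have "\<dots> \<le> norm (p j) * norm (\<theta> k - \<theta> j)"
      by (metis Cauchy_Schwarz_ineq2 mult.commute)
    finally show "\<bar>(a j k - 1 / n) * (\<theta> k \<bullet> p j)\<bar>
        \<le> (18/100) / n\<^sup>2 * (norm (p j) * norm (\<theta> k - \<theta> j))"
      unfolding abs_mult using weights_near by (intro mult_mono) auto
  qed
  finally show ?thesis by (simp add: err_def sum_distrib_left)
qed

lemma sum_err: "(\<Sum>j\<in>UNIV. err j) \<le> 36/100 * M"
proof -
  \<comment> \<open>Young's inequality, weighted by n so that the distance terms sum to only n Var /
    2, which \<open>M_lower\<close> absorbs into n M.\<close>
  have "norm (p j) * norm (\<theta> k - \<theta> j)
      \<le> n * (norm (p j))\<^sup>2 + (1 / (4 * n)) * (norm (\<theta> k - \<theta> j))\<^sup>2" for j k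
  proof -
    have "0 \<le> (2 * n * norm (p j) - norm (\<theta> k - \<theta> j))\<^sup>2 / (4 * n)"
      using n_ge_1 by (intro divide_nonneg_nonneg) auto
    also have "\<dots> = n * (norm (p j))\<^sup>2 + (1 / (4 * n)) * (norm (\<theta> k - \<theta> j))\<^sup>2
        - norm (p j) * norm (\<theta> k - \<theta> j)"
      using n_ge_1 by (simp add: power2_eq_square field_simps)
    finally show ?thesis by simp
  qed
  then have "(\<Sum>j\<in>UNIV. \<Sum>k\<in>UNIV. norm (p j) * norm (\<theta> k - \<theta> j))
      \<le> (\<Sum>j\<in>UNIV. \<Sum>k\<in>UNIV. n * (norm (p j))\<^sup>2 + (1 / (4 * n)) * (norm (\<theta> k - \<theta> j))\<^sup>2)"
    by (intro sum_mono)
  also have "\<dots> = n * n * M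
      + (1 / (4 * n)) * (\<Sum>j\<in>UNIV. \<Sum>k\<in>UNIV. (norm (\<theta> k - \<theta> j))\<^sup>2)"
    by (simp add: sum.distrib M_def sum_distrib_left mult.assoc)
  also have "(\<Sum>j\<in>UNIV. \<Sum>k\<in>UNIV. (norm (\<theta> k - \<theta> j))\<^sup>2) = 2 * n\<^sup>2 * Var \<theta>"
  proof -
    have "(norm (\<theta> k - \<theta> j))\<^sup>2 = 2 - 2 * (\<theta> k \<bullet> \<theta> j)" for j k
      by (simp add: power2_norm_eq_inner inner_diff inner_self inner_commute)
    then have "(\<Sum>j\<in>UNIV. \<Sum>k\<in>UNIV. (norm (\<theta> k - \<theta> j))\<^sup>2)
        = (\<Sum>j\<in>UNIV. 2 * n - 2 * n * (\<theta> j \<bullet> center \<theta>))"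
      by (simp add: sum_subtractf sum_inner_center flip: sum_distrib_left)
    also have "\<dots> = 2 * n\<^sup>2 * Var \<theta>"
      by (simp add: sum_subtractf sum_inner_center Var_unit unit flip: sum_distrib_left)
        (simp add: power2_norm_eq_inner power2_eq_square[of n] algebra_simps)
    finally show ?thesis .
  qed
  also have "n * n * M + (1 / (4 * n)) * (2 * n\<^sup>2 * Var \<theta>) = n * n * M + n * (Var \<theta> / 2)"
    using n_ge_1 by (simp add: power2_eq_square)
  also have "\<dots> \<le> n * n * M + n * M"
    using M_lower n_ge_1 by simp
  also have "\<dots> \<le> 2 * n\<^sup>2 * M"
  proof -
    have "M \<ge> 0" by (simp add: M_def sum_nonneg)
    then have "n * M * 1 \<le> n * M * n" using n_ge_1 by (intro mult_left_mono) auto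
    then show ?thesis by (simp add: power2_eq_square algebra_simps)
  qed
  finally have *: "(\<Sum>j\<in>UNIV. \<Sum>k\<in>UNIV. norm (p j) * norm (\<theta> k - \<theta> j)) \<le> 2 * n\<^sup>2 * M" .
  have "(\<Sum>j\<in>UNIV. err j) = (18/100) / n\<^sup>2 * (\<Sum>j\<in>UNIV. \<Sum>k\<in>UNIV. norm (p j) * norm (\<theta> k - \<theta> j))"
    unfolding err_def sum_distrib_left ..
  also have "\<dots> \<le> (18/100) / n\<^sup>2 * (2 * n\<^sup>2 * M)"
    using * by (intro mult_left_mono) auto
  also have "\<dots> = 36/100 * M"
    using n_ge_1 by simp
  finally show ?thesis .
qed

text \<open>The attention error consumes at most \<open>0.36 M\<close>, which leaves room for rates that differ by a
  factor of two.\<close>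

lemma dissipation:
  assumes w: "\<And>j. w0 \<le> w j" "\<And>j. w j \<le> 2 * w0" and "w0 \<ge> 0"
  shows "(\<Sum>j\<in>UNIV. w j * (A j \<bullet> p j)) \<ge> 14/100 * w0 * Var \<theta>"
    and "(\<Sum>j\<in>UNIV. w j * (A j \<bullet> p j)) \<le> 3 * w0 * n * Var \<theta>"
proof -
  have err_nonneg: "err j \<ge> 0" for j
    using drift_near[of j] by linarith
  \<comment> \<open>The sign of A_j \<bullet> p_j is unknown. The main term therefore takes the
    smallest weight \<open>w0\<close> and the error the largest, \<open>2 * w0\<close>.\<close>
  have lower: "w0 * (norm (p j))\<^sup>2 - 2 * w0 * err j \<le> w j * (A j \<bullet> p j)" for j
  proof -
    have "w0 * (norm (p j))\<^sup>2 \<le> w j * (norm (p j))\<^sup>2"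
      by (intro mult_right_mono w) simp
    moreover have "w j * err j \<le> 2 * w0 * err j"
      by (intro mult_right_mono w err_nonneg)
    moreover have "w j * ((norm (p j))\<^sup>2 - err j) \<le> w j * (A j \<bullet> p j)"
      using drift_near[of j] w(1)[of j] \<open>w0 \<ge> 0\<close> by (intro mult_left_mono) (auto simp: abs_le_iff)
    ultimately show ?thesis by (simp add: right_diff_distrib)
  qed
  have upper: "w j * (A j \<bullet> p j) \<le> 2 * w0 * (norm (p j))\<^sup>2 + 2 * w0 * err j" for j
  proof -
    have "w j * (A j \<bullet> p j) \<le> w j * ((norm (p j))\<^sup>2 + err j)"
      using drift_near[of j] w(1)[of j] \<open>w0 \<ge> 0\<close> by (intro mult_left_mono) (auto simp: abs_le_iff)
    also have "\<dots> \<le> (2 * w0) * ((norm (p j))\<^sup>2 + err j)"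
      by (intro mult_right_mono w add_nonneg_nonneg err_nonneg) simp
    finally show ?thesis by (simp add: distrib_left)
  qed
  have e: "2 * w0 * (\<Sum>j\<in>UNIV. err j) \<le> 2 * w0 * (36/100 * M)"
    using sum_err \<open>w0 \<ge> 0\<close> by (intro mult_left_mono) auto
  \<comment> \<open>The remaining share is 1 - 2 * 0.36 = 0.28 of \<open>w0 * M\<close>, and M \<ge>
    Var / 2 halves it to 0.14.\<close>
  have "w0 * M - 2 * w0 * (\<Sum>j\<in>UNIV. err j) \<le> (\<Sum>j\<in>UNIV. w j * (A j \<bullet> p j))"
    using sum_mono[of UNIV, OF lower] by (simp add: sum_subtractf M_def sum_distrib_left)
  moreover have "w0 * M \<ge> w0 * (Var \<theta> / 2)"
    using M_lower \<open>w0 \<ge> 0\<close> by (intro mult_left_mono) auto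
  ultimately show "(\<Sum>j\<in>UNIV. w j * (A j \<bullet> p j)) \<ge> 14/100 * w0 * Var \<theta>"
    using e by simp
  have "(\<Sum>j\<in>UNIV. w j * (A j \<bullet> p j)) \<le> 2 * w0 * M + 2 * w0 * (\<Sum>j\<in>UNIV. err j)"
    using sum_mono[of UNIV, OF upper] by (simp add: sum.distrib M_def sum_distrib_left)
  \<comment> \<open>Here 2 + 2 * 0.36 is rounded up to 3.\<close>
  also have "\<dots> \<le> 3 * (w0 * M)"
  proof -
    have "w0 * M \<ge> 0" using \<open>w0 \<ge> 0\<close> by (simp add: M_def sum_nonneg)
    then show ?thesis using e by simp
  qed
  also have "\<dots> \<le> 3 * (w0 * (n * Var \<theta>))"
    using M_upper \<open>w0 \<ge> 0\<close> by (intro mult_left_mono) auto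
  finally show "(\<Sum>j\<in>UNIV. w j * (A j \<bullet> p j)) \<le> 3 * w0 * n * Var \<theta>"
    by (simp add: mult.assoc)
qed

end

section \<open>Softmax weights in the cone\<close>

definition attn_weight ::
  "real \<Rightarrow> real^'d^'d \<Rightarrow> real^'d^'d \<Rightarrow> ('n::finite \<Rightarrow> real^'d) \<Rightarrow> 'n \<Rightarrow> 'n \<Rightarrow> real" where
  "attn_weight \<beta> Q K \<theta> j k = exp (\<beta> * ((Q *v \<theta> j) \<bullet> (K *v \<theta> k)))
     / (\<Sum>l\<in>UNIV. exp (\<beta> * ((Q *v \<theta> j) \<bullet> (K *v \<theta> l))))"

lemma attention_eq: "attention \<beta> Q K \<theta> j = (\<Sum>k\<in>UNIV. attn_weight \<beta> Q K \<theta> j k *\<^sub>R \<theta> k)"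
  by (simp add: attention_def attn_weight_def)

lemma attn_weight_nonneg: "attn_weight \<beta> Q K \<theta> j k \<ge> 0"
  by (simp add: attn_weight_def sum_nonneg)

lemma sum_attn_weight: "(\<Sum>k\<in>UNIV. attn_weight \<beta> Q K \<theta> j k) = 1"
proof -
  have "(\<Sum>l\<in>UNIV. exp (\<beta> * ((Q *v \<theta> j) \<bullet> (K *v \<theta> l)))) > 0"
    by (intro sum_pos) auto
  then show ?thesis
    by (simp add: attn_weight_def flip: sum_divide_distrib)
qed

text \<open>The score is the bilinear form of \<open>transpose Q ** K\<close>, so the operator norm
  bound makes it 1-Lipschitz in the key token.\<close>

lemma score_diff_le:
  fixes Q K :: "real^'d^'d"
  assumes "onorm (\<lambda>x. (transpose Q ** K) *v x) \<le> 1" "norm u = 1"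
  shows "(Q *v u) \<bullet> (K *v x) - (Q *v u) \<bullet> (K *v y) \<le> norm (x - y)"
proof -
  have "(Q *v u) \<bullet> (K *v x) - (Q *v u) \<bullet> (K *v y) = (Q *v u) \<bullet> (K *v (x - y))"
    by (simp add: inner_diff_right matrix_vector_mult_diff_distrib)
  also have "\<dots> = u \<bullet> ((transpose Q ** K) *v (x - y))"
    by (metis dot_lmul_matrix matrix_vector_mul_assoc transpose_matrix_vector transpose_transpose)
  also have "\<dots> \<le> norm u * norm ((transpose Q ** K) *v (x - y))"
    by (rule norm_cauchy_schwarz)
  also have "\<dots> \<le> norm (x - y)"
  proof -
    have "norm ((transpose Q ** K) *v (x - y))
        \<le> onorm (\<lambda>x. (transpose Q ** K) *v x) * norm (x - y)"
      by (rule onorm[OF matrix_vector_mul_bounded_linear])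
    also have "\<dots> \<le> 1 * norm (x - y)"
      by (intro mult_right_mono assms) simp
    finally show ?thesis using assms by simp
  qed
  finally show ?thesis .
qed

text \<open>Tokens in the cone are at distance at most sqrt (2 \<delta>), so the exponents of a row
  differ by at most \<beta> sqrt (2 \<delta>) and its weights agree up to a factor close to
  1.\<close>

lemma attn_weight_near_uniform:
  fixes \<theta> :: "'n::finite \<Rightarrow> real^'d"
  defines "n \<equiv> real CARD('n)"
  assumes "\<beta> > 0" "onorm (\<lambda>x. (transpose Q ** K) *v x) \<le> 1"
    and \<delta>: "\<delta> < 1 / (100 * n\<^sup>2 * \<beta>\<^sup>2)"
    and unit: "\<And>j. norm (\<theta> j) = 1" and cone: "in_cone \<delta> \<theta>"
  shows "\<bar>attn_weight \<beta> Q K \<theta> j k - 1 / n\<bar> \<le> (18/100) / n\<^sup>2"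
proof -
  \<comment> \<open>The smallness of \<delta> bounds \<beta> sqrt (2 \<delta>) by sqrt 2 / (10 n),
    which is about 0.1414/n. This is rounded up to 0.15/n.\<close>
  define \<epsilon> where "\<epsilon> = (15/100) / n"
  define e where "e k = exp (\<beta> * ((Q *v \<theta> j) \<bullet> (K *v \<theta> k)))" for k
  have n: "n \<ge> 1" by (simp add: n_def Suc_leI)
  then have \<epsilon>: "0 \<le> \<epsilon>" "\<epsilon> \<le> 15/100" by (auto simp: \<epsilon>_def field_simps)
  have "\<beta> * norm (\<theta> k - \<theta> l) \<le> \<epsilon>" for k l
  proof (rule power2_le_imp_le)
    have "(norm (\<theta> k - \<theta> l))\<^sup>2 = 2 - 2 * (\<theta> k \<bullet> \<theta> l)"
      using unit[of k] unit[of l]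
      by (simp add: power2_norm_eq_inner inner_diff inner_commute norm_eq_1)
    also have "\<dots> \<le> 2 * \<delta>"
      using cone[unfolded in_cone_def, rule_format, of k l] by simp
    finally have "(\<beta> * norm (\<theta> k - \<theta> l))\<^sup>2 \<le> \<beta>\<^sup>2 * (2 * \<delta>)"
      by (simp add: power_mult_distrib mult_left_mono)
    also have "\<dots> \<le> \<beta>\<^sup>2 * (2 * (1 / (100 * n\<^sup>2 * \<beta>\<^sup>2)))"
      using \<delta> by (intro mult_left_mono) auto
    also have "\<dots> \<le> \<epsilon>\<^sup>2"
      using \<open>\<beta> > 0\<close> n by (simp add: \<epsilon>_def power_divide field_simps)
    finally show "(\<beta> * norm (\<theta> k - \<theta> l))\<^sup>2 \<le> \<epsilon>\<^sup>2" .
  qed (use \<epsilon> in auto)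
  moreover have "\<beta> * ((Q *v \<theta> j) \<bullet> (K *v \<theta> k) - (Q *v \<theta> j) \<bullet> (K *v \<theta> l))
      \<le> \<beta> * norm (\<theta> k - \<theta> l)" for k l
    using \<open>\<beta> > 0\<close> assms(3) unit by (intro mult_left_mono score_diff_le) auto
  ultimately have "\<beta> * ((Q *v \<theta> j) \<bullet> (K *v \<theta> k))
      \<le> \<epsilon> + \<beta> * ((Q *v \<theta> j) \<bullet> (K *v \<theta> l))" for k l
    by (smt (verit) right_diff_distrib)
  then have ratio: "e k \<le> exp \<epsilon> * e l" for k l
    unfolding e_def exp_add[symmetric] by simp
  have pos: "sum e UNIV > 0"
    by (intro sum_pos) (auto simp: e_def)
  have "n * e k \<le> exp \<epsilon> * sum e UNIV"
    using sum_mono[of UNIV "\<lambda>_. e k", OF ratio] by (simp add: n_def sum_distrib_left)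
  then have "e k / sum e UNIV \<le> exp \<epsilon> / n"
    using pos n by (simp add: field_simps)
  also have "\<dots> \<le> (1 + \<epsilon> + \<epsilon>\<^sup>2) / n"
    using exp_bound[of \<epsilon>] \<epsilon> n by (intro divide_right_mono) auto
  \<comment> \<open>Since \<epsilon> \<le> 0.15, \<epsilon> + \<epsilon>^2 is at most 1.15 * 0.15/n
    = 0.1725/n. This is the origin of the constant 0.18.\<close>
  also have "\<dots> \<le> (1 + (18/100) / n) / n"
  proof -
    have "\<epsilon> * \<epsilon> \<le> \<epsilon> * (15/100)" using \<epsilon> by (intro mult_left_mono) auto
    then have "\<epsilon> + \<epsilon>\<^sup>2 \<le> (18/100) / n"
      using n by (simp add: \<epsilon>_def power2_eq_square field_simps)
    then show ?thesis using n by (intro divide_right_mono) auto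
  qed
  finally have upper: "e k / sum e UNIV \<le> 1 / n + (18/100) / n\<^sup>2"
    by (simp add: add_divide_distrib power2_eq_square)
  have "sum e UNIV \<le> n * exp \<epsilon> * e k"
    using sum_mono[of UNIV _ "\<lambda>_. exp \<epsilon> * e k", of e] ratio by (simp add: n_def)
  then have "exp (- \<epsilon>) / n \<le> e k / sum e UNIV"
    using pos n by (simp add: exp_minus field_simps)
  moreover have "(1 - \<epsilon>) / n \<le> exp (- \<epsilon>) / n"
    using exp_ge_add_one_self[of "- \<epsilon>"] n by (intro divide_right_mono) auto
  moreover have "(1 - \<epsilon>) / n \<ge> 1 / n - (18/100) / n\<^sup>2"
    using n by (simp add: \<epsilon>_def power2_eq_square field_simps)
  ultimately show ?thesis
    using upper by (simp add: attn_weight_def e_def abs_le_iff)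
qed

text \<open>The bound \<delta> < 1 supplies nonnegative inner products. It is stated separately
  because for n \<beta> < 1/10 the other bound on \<delta> does not imply it.\<close>

lemma near_uniform_attention_in_cone:
  fixes \<theta> :: "'n::finite \<Rightarrow> real^'d"
  assumes "\<beta> > 0" "onorm (\<lambda>x. (transpose Q ** K) *v x) \<le> 1"
    and "\<delta> < 1 / (100 * (real CARD('n))\<^sup>2 * \<beta>\<^sup>2)" "\<delta> < 1"
    and "\<And>j. norm (\<theta> j) = 1" "in_cone \<delta> \<theta>"
  shows "near_uniform_attention \<theta> (attn_weight \<beta> Q K \<theta>) (real CARD('n))"
proof
  show "0 \<le> \<theta> j \<bullet> \<theta> k" for j k
    using assms(4,6) by (smt (verit) in_cone_def)
  show "\<bar>attn_weight \<beta> Q K \<theta> j k - 1 / real CARD('n)\<bar> \<le> (18/100) / (real CARD('n))\<^sup>2" for j k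
    using assms by (intro attn_weight_near_uniform)
qed (simp_all add: assms sum_attn_weight)

text \<open>The mean value theorem, with derivatives at interior points only, so that radii can be
  followed from time 0 or from the switching time.\<close>

lemma increment_bounds:
  fixes f :: "real \<Rightarrow> real"
  assumes "continuous_on {a..b} f" "a \<le> b"
    and "\<And>t. a < t \<Longrightarrow> t < b \<Longrightarrow> \<exists>D. (f has_real_derivative D) (at t) \<and> l \<le> D \<and> D \<le> u"
  shows "l * (b - a) \<le> f b - f a" "f b - f a \<le> u * (b - a)"
proof -
  have "l * (b - a) \<le> f b - f a \<and> f b - f a \<le> u * (b - a)"
  proof (cases "a = b")
    case False
    then have "a < b" using assms by simp
    obtain f' where f': "\<And>t. a < t \<Longrightarrow> t < b \<Longrightarrow>
        (f has_real_derivative f' t) (at t) \<and> l \<le> f' t \<and> f' t \<le> u"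
      using assms(3) by metis
    obtain \<xi> where "a < \<xi>" "\<xi> < b" "f b - f a = f' \<xi> * (b - a)"
      using mvt[OF \<open>a < b\<close> assms(1), of "\<lambda>t. (*) (f' t)"] f'
      by (auto simp: has_field_derivative_def)
    then show ?thesis using f'[of \<xi>] \<open>a < b\<close> by (simp add: mult_right_mono)
  qed simp
  then show "l * (b - a) \<le> f b - f a" "f b - f a \<le> u * (b - a)" by auto
qed

section \<open>Flows in the cone\<close>

text \<open>The last assumption is automatic for all schemes except nGPT, where it rules out
  negative \<alpha>.\<close>

locale cone_attention_flow =
  fixes \<beta> \<delta> :: real and Q K :: "real^'d^'d" and S :: scheme
    and \<Theta> :: "real \<Rightarrow> 'n::finite \<Rightarrow> real^'d" and r :: "real \<Rightarrow> 'n \<Rightarrow> real"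
  assumes \<beta>_pos: "\<beta> > 0"
    and onorm_le: "onorm (\<lambda>x. (transpose Q ** K) *v x) \<le> 1"
    and \<delta>_small: "\<delta> < 1 / (100 * (real CARD('n))\<^sup>2 * \<beta>\<^sup>2)"
    and \<delta>_less_1: "\<delta> < 1"
    and flow: "cone_flow \<beta> Q K \<delta> S \<Theta> r"
    and speed_nonneg: "\<And>t x (A :: real^'d). t > 0 \<Longrightarrow> x \<ge> 0 \<Longrightarrow> speed S t x A \<ge> 0"
begin

definition "att t j = attention \<beta> Q K (\<Theta> t) j"
text \<open>Where the speed vanishes, the quotient is 0 by convention and hence still
  nonnegative.\<close>

definition "rate t j = 1 / speed S t (r t j) (att t j)"
text \<open>The contribution of the motion of token i to the derivative of \<theta>_i \<bullet>
  \<theta>_j, before multiplication by its rate.\<close>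

definition "drift t i j = (att t i - (\<Theta> t i \<bullet> att t i) *\<^sub>R \<Theta> t i) \<bullet> \<Theta> t j"

lemma attention_flow: "attention_flow \<beta> Q K S \<Theta> r"
  and init: "in_cone \<delta> (\<Theta> 0)"
  using flow by (auto simp: cone_flow_def)

lemma unit: "t \<ge> 0 \<Longrightarrow> norm (\<Theta> t j) = 1"
  and r_nonneg: "t \<ge> 0 \<Longrightarrow> r t j \<ge> 0"
  and cont_\<Theta>: "continuous_on {0..} (\<lambda>t. \<Theta> t j)"
  and cont_r: "continuous_on {0..} (\<lambda>t. r t j)"
  using attention_flow by (auto simp: attention_flow_def)

lemma rate_nonneg: "t > 0 \<Longrightarrow> rate t j \<ge> 0"
  using speed_nonneg[of t "r t j"] r_nonneg[of t j] by (simp add: rate_def)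

lemma deriv_\<Theta>:
  assumes "t > 0" "t \<notin> switching_times S"
  shows "((\<lambda>u. \<Theta> u j) has_vector_derivative
    rate t j *\<^sub>R (att t j - (\<Theta> t j \<bullet> att t j) *\<^sub>R \<Theta> t j)) (at t)"
  using attention_flow assms
  by (simp add: attention_flow_def tangent_proj_mult rate_def att_def)

lemma deriv_r:
  assumes "t > 0" "t \<notin> switching_times S"
  shows "((\<lambda>u. r u j) has_real_derivative radial_rate S t (\<Theta> t j) (att t j)) (at t)"
  using attention_flow assms by (simp add: attention_flow_def att_def)

section \<open>Evolution of inner products and invariance of the cone\<close>

lemma deriv_inner:
  assumes "t > 0" "t \<notin> switching_times S"
  shows "((\<lambda>u. \<Theta> u i \<bullet> \<Theta> u j) has_real_derivative
    rate t i * drift t i j + rate t j * drift t j i) (at t)"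
proof -
  note has_derivative_inner[OF deriv_\<Theta>[OF assms, of i, unfolded has_vector_derivative_def]
    deriv_\<Theta>[OF assms, of j, unfolded has_vector_derivative_def]]
  then show ?thesis
    by (auto simp: has_field_derivative_def drift_def inner_commute algebra_simps
        elim!: has_derivative_eq_rhs)
qed

text \<open>With m the minimal inner product, the drift is the weighted sum of \<theta>_k \<bullet>
  \<theta>_j - (\<theta>_i \<bullet> \<theta>_k) m. Each term is nonnegative, as the first part is
  at least m and the second at most m. The term k = j alone gives the bound.\<close>

lemma drift_lower:
  assumes "t \<ge> 0" and min: "\<And>k l. \<Theta> t i \<bullet> \<Theta> t j \<le> \<Theta> t k \<bullet> \<Theta> t l"
    and nonneg: "\<Theta> t i \<bullet> \<Theta> t j \<ge> 0"
  shows "drift t i j \<ge> attn_weight \<beta> Q K (\<Theta> t) i j * (1 - (\<Theta> t i \<bullet> \<Theta> t j)\<^sup>2)"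
proof -
  define m where "m = \<Theta> t i \<bullet> \<Theta> t j"
  define a where "a = attn_weight \<beta> Q K (\<Theta> t) i"
  have "drift t i j = (\<Sum>k\<in>UNIV. a k * (\<Theta> t k \<bullet> \<Theta> t j - (\<Theta> t i \<bullet> \<Theta> t k) * m))"
    by (simp add: drift_def att_def attention_eq a_def m_def inner_diff_left inner_sum_left
        inner_sum_right sum_subtractf right_diff_distrib sum_distrib_right mult.assoc)
  moreover have "a k * (\<Theta> t k \<bullet> \<Theta> t j - (\<Theta> t i \<bullet> \<Theta> t k) * m) \<ge> 0" for k
  proof -
    have "(\<Theta> t i \<bullet> \<Theta> t k) * m \<le> 1 * m"
      using norm_cauchy_schwarz[of "\<Theta> t i" "\<Theta> t k"] nonneg assms(1)
      by (intro mult_right_mono) (auto simp: unit m_def)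
    then have "(\<Theta> t i \<bullet> \<Theta> t k) * m \<le> \<Theta> t k \<bullet> \<Theta> t j"
      using min[of k j] by (simp add: m_def)
    then show ?thesis by (simp add: a_def attn_weight_nonneg)
  qed
  ultimately have "a j * (\<Theta> t j \<bullet> \<Theta> t j - (\<Theta> t i \<bullet> \<Theta> t j) * m) \<le> drift t i j"
    using member_le_sum[of j UNIV "\<lambda>k. a k * (\<Theta> t k \<bullet> \<Theta> t j - (\<Theta> t i \<bullet> \<Theta> t k) * m)"] by simp
  moreover have "\<Theta> t j \<bullet> \<Theta> t j = 1"
    using unit[OF assms(1), of j] by (simp add: norm_eq_1)
  ultimately show ?thesis by (simp add: a_def m_def power2_eq_square)
qed

lemma inner_le_1: "t \<ge> 0 \<Longrightarrow> \<Theta> t i \<bullet> \<Theta> t j \<le> 1"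
  using norm_cauchy_schwarz[of "\<Theta> t i" "\<Theta> t j"] by (simp add: unit)

lemma cont_inner: "a \<ge> 0 \<Longrightarrow> continuous_on {a..b} (\<lambda>t. \<Theta> t i \<bullet> \<Theta> t j)"
  by (intro continuous_on_inner continuous_on_subset[OF cont_\<Theta>]) auto

text \<open>The smallest inner product does not decrease; tilting the barrier by \<open>\<eta>\<close> makes
  its derivative strictly positive at a first exit.\<close>

lemma cone_step:
  assumes "0 \<le> a" "a \<le> b" and no_switch: "{a<..<b} \<inter> switching_times S = {}"
    and start: "in_cone \<delta> (\<Theta> a)"
  shows "in_cone \<delta> (\<Theta> b)"
  unfolding in_cone_def
proof (intro allI, rule field_le_epsilon)
  fix i j and \<epsilon> :: real
  assume "\<epsilon> > 0"
  \<comment> \<open>The second entry of the minimum keeps the tilted level 1 - \<delta> -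
    \<open>\<eta> * (1 + t - a)\<close> positive, so a touching inner product is positive. The
    summand 1 in the tilt makes \<open>f\<close> strictly positive at the start.\<close>
  define \<mu> where "\<mu> = min \<epsilon> ((1 - \<delta>) / 2)"
  define \<eta> where "\<eta> = \<mu> / (1 + b - a)"
  have "\<mu> > 0" "\<mu> \<le> \<epsilon>" "\<mu> < 1 - \<delta>"
    using \<open>\<epsilon> > 0\<close> \<delta>_less_1 by (auto simp: \<mu>_def min_def)
  moreover have "1 + b - a > 0" using assms(2) by simp
  ultimately have "\<eta> > 0" and \<eta>: "\<eta> * (1 + b - a) \<le> \<epsilon>" "\<eta> * (1 + b - a) < 1 - \<delta>"
    by (simp_all add: \<eta>_def)
  define f where "f p t = \<Theta> t (fst p) \<bullet> \<Theta> t (snd p) + (\<eta> * (1 + t - a) - (1 - \<delta>))" for p t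
  have "f (i, j) b \<ge> 0"
  proof (rule finite_barrier[where f = f and a = a and b = b])
    show "continuous_on {a..b} (f p)" for p
      unfolding f_def by (intro continuous_intros cont_inner assms(1))
    show "f p a > 0" for p
      using start[unfolded in_cone_def, rule_format, of "fst p" "snd p"] \<open>\<eta> > 0\<close>
      by (simp add: f_def)
    fix t p assume t: "a < t" "t < b" and f: "\<forall>q. f q t \<ge> 0" "f p t = 0"
    obtain k l where p: "p = (k, l)" by fastforce
    have "t > 0" "t \<notin> switching_times S" using t assms(1) no_switch by auto
    \<comment> \<open>All pairs carry the same tilt, so the pair that touches the barrier has the
      smallest inner product.\<close>
    have min: "\<Theta> t k \<bullet> \<Theta> t l \<le> \<Theta> t k' \<bullet> \<Theta> t l'" for k' l'
      using f(1)[rule_format, of "(k', l')"] f(2) by (simp add: f_def p)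
    have "\<eta> * (1 + t - a) \<le> \<eta> * (1 + b - a)"
      using t \<open>\<eta> > 0\<close> by (intro mult_left_mono) auto
    then have nonneg: "\<Theta> t k \<bullet> \<Theta> t l \<ge> 0"
      using f(2) \<eta>(2) by (simp add: f_def p)
    then have sq: "(\<Theta> t k \<bullet> \<Theta> t l)\<^sup>2 \<le> 1"
      using inner_le_1[of t k l] \<open>t > 0\<close> by (simp add: abs_square_le_1)
    have "drift t i j \<ge> 0" if ij: "(i, j) = (k, l) \<or> (i, j) = (l, k)" for i j
    proof -
      have ij: "\<Theta> t i \<bullet> \<Theta> t j = \<Theta> t k \<bullet> \<Theta> t l"
        using ij by (auto simp: inner_commute)
      have "0 \<le> attn_weight \<beta> Q K (\<Theta> t) i j * (1 - (\<Theta> t i \<bullet> \<Theta> t j)\<^sup>2)"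
        unfolding ij using sq by (intro mult_nonneg_nonneg attn_weight_nonneg) simp
      also have "\<dots> \<le> drift t i j"
        using min nonneg \<open>t > 0\<close> by (intro drift_lower) (simp_all add: ij)
      finally show ?thesis .
    qed
    then have "drift t k l \<ge> 0" "drift t l k \<ge> 0" by auto
    then have "rate t k * drift t k l + rate t l * drift t l k + \<eta> > 0"
      using rate_nonneg \<open>t > 0\<close> \<open>\<eta> > 0\<close> by (simp add: add_nonneg_pos)
    moreover have "(f p has_real_derivative
        rate t k * drift t k l + rate t l * drift t l k + \<eta>) (at t)"
      unfolding f_def p fst_conv snd_conv
      by (rule DERIV_add[OF deriv_inner[OF \<open>t > 0\<close> \<open>t \<notin> _\<close>]])
        (auto intro!: derivative_eq_intros)
    ultimately show "\<exists>D>0. (f p has_real_derivative D) (at t)" by blast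
  qed (use assms in auto)
  then show "1 - \<delta> \<le> \<Theta> b i \<bullet> \<Theta> b j + \<epsilon>"
    using \<eta>(1) by (simp add: f_def)
qed

text \<open>A switching time inside the interval splits it in two. Continuity carries the cone up to
  that time, and the second step starts from there.\<close>

lemma in_cone:
  assumes "t \<ge> 0"
  shows "in_cone \<delta> (\<Theta> t)"
proof -
  obtain \<tau> where \<tau>: "switching_times S \<subseteq> {\<tau>}"
    by (cases S) auto
  show ?thesis
  proof (cases "0 \<le> \<tau> \<and> \<tau> \<le> t")
    case True
    then have "in_cone \<delta> (\<Theta> \<tau>)"
      by (intro cone_step[of 0 \<tau>] init) (use \<tau> in auto)
    then show ?thesis
      by (intro cone_step[of \<tau> t]) (use \<tau> True in auto)
  next
    case False
    then show ?thesis
      by (intro cone_step[of 0 t] init) (use \<tau> assms in auto)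
  qed
qed

section \<open>Attention vectors and derivative of the variance in the cone\<close>

lemma inner_pos: "t \<ge> 0 \<Longrightarrow> \<Theta> t i \<bullet> \<Theta> t j > 0"
  using in_cone[of t] \<delta>_less_1 by (smt (verit) in_cone_def)

lemma near_uniform:
  "t \<ge> 0 \<Longrightarrow> near_uniform_attention (\<Theta> t) (attn_weight \<beta> Q K (\<Theta> t)) (real CARD('n))"
  using near_uniform_attention_in_cone[OF \<beta>_pos onorm_le \<delta>_small \<delta>_less_1 unit in_cone] .

lemma att_eq_A: "t \<ge> 0 \<Longrightarrow>
  att t j = near_uniform_attention.A (\<Theta> t) (attn_weight \<beta> Q K (\<Theta> t)) j"
  using near_uniform_attention.A_def[OF near_uniform] by (simp add: att_def attention_eq)

lemma norm_att_le: "t \<ge> 0 \<Longrightarrow> norm (att t j) \<le> 1"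
  using near_uniform_attention.norm_A_le[OF near_uniform] by (simp add: att_eq_A)

text \<open>The left-hand side is a convex combination of inner products. The width \<eta> is kept
  free because narrower cones than the initial one are used at late times.\<close>

lemma inner_att_ge:
  assumes "in_cone \<eta> (\<Theta> t)"
  shows "\<Theta> t j \<bullet> att t j \<ge> 1 - \<eta>"
proof -
  have "1 - \<eta> = (\<Sum>k\<in>UNIV. attn_weight \<beta> Q K (\<Theta> t) j k * (1 - \<eta>))"
    by (simp add: sum_attn_weight flip: sum_distrib_right)
  also have "\<dots> \<le> (\<Sum>k\<in>UNIV. attn_weight \<beta> Q K (\<Theta> t) j k * (\<Theta> t j \<bullet> \<Theta> t k))"
    using assms by (intro sum_mono mult_left_mono attn_weight_nonneg) (auto simp: in_cone_def)
  also have "\<dots> = \<Theta> t j \<bullet> att t j"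
    by (simp add: att_def attention_eq inner_sum_right)
  finally show ?thesis .
qed

lemma deriv_Var:
  assumes "t > 0" "t \<notin> switching_times S"
  shows "((\<lambda>u. Var (\<Theta> u)) has_real_derivative
    - (2 / real CARD('n)) * (\<Sum>j\<in>UNIV. rate t j *
        (att t j \<bullet> near_uniform_attention.p (\<Theta> t) j))) (at t)"
proof -
  define c' where "c' = (1 / real CARD('n)) *\<^sub>R
    (\<Sum>j\<in>UNIV. rate t j *\<^sub>R (att t j - (\<Theta> t j \<bullet> att t j) *\<^sub>R \<Theta> t j))"
  have "((\<lambda>u. center (\<Theta> u)) has_vector_derivative c') (at t)"
    unfolding center_def c'_def
    by (intro bounded_linear.has_vector_derivative[OF bounded_linear_scaleR_right]
        has_vector_derivative_sum deriv_\<Theta> assms)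
  note has_derivative_inner[OF this[unfolded has_vector_derivative_def]
    this[unfolded has_vector_derivative_def]]
  then have "((\<lambda>u. center (\<Theta> u) \<bullet> center (\<Theta> u)) has_real_derivative
      2 * (c' \<bullet> center (\<Theta> t))) (at t)"
    by (auto simp: has_field_derivative_def inner_commute algebra_simps
        elim!: has_derivative_eq_rhs)
  then have "((\<lambda>u. 1 - (norm (center (\<Theta> u)))\<^sup>2) has_real_derivative
      - 2 * (c' \<bullet> center (\<Theta> t))) (at t)"
    unfolding power2_norm_eq_inner by (auto intro!: derivative_eq_intros)
  \<comment> \<open>The tokens are known to be unit vectors only for nonnegative times, so the two
    functions are compared on the open half-line.\<close>
  then have "((\<lambda>u. Var (\<Theta> u)) has_real_derivative - 2 * (c' \<bullet> center (\<Theta> t))) (at t)"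
    by (rule has_field_derivative_transform_within_open[where S = "{0<..}"])
      (use assms in \<open>auto simp: Var_unit unit\<close>)
  \<comment> \<open>The projection is self-adjoint, so it moves from A_j onto the center.\<close>
  moreover have "(att t j - (\<Theta> t j \<bullet> att t j) *\<^sub>R \<Theta> t j) \<bullet> center (\<Theta> t)
      = att t j \<bullet> near_uniform_attention.p (\<Theta> t) j" for j
    using assms near_uniform_attention.p_def[OF near_uniform[of t], of j]
    by (simp add: inner_diff inner_commute)
  ultimately show ?thesis
    by (simp add: c'_def inner_sum_left)
qed

text \<open>The constants 0.28 and 6 are those of \<open>dissipation\<close>, doubled by the factor
  2/n in \<open>deriv_Var\<close>. Each scheme inserts its own comparison quantity
  \<open>x\<close>.\<close>

lemma Var_decay_of_rates:
  assumes "t > 0" "t \<notin> switching_times S" "w \<ge> 0"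
    and "\<And>j. w \<le> rate t j" "\<And>j. rate t j \<le> 2 * w"
    and c: "c * x \<le> (28/100) / real CARD('n) * (w * Var (\<Theta> t))"
    and C: "6 * (w * Var (\<Theta> t)) \<le> C * x"
  shows "Var_decay c C \<Theta> t x"
proof -
  define d where "d = (\<Sum>j\<in>UNIV. rate t j * (att t j \<bullet> near_uniform_attention.p (\<Theta> t) j))"
  define n where "n = real CARD('n)"
  have "n > 0" by (simp add: n_def)
  have d: "14/100 * w * Var (\<Theta> t) \<le> d" "d \<le> 3 * w * n * Var (\<Theta> t)"
    using near_uniform_attention.dissipation[OF near_uniform[of t], of w "rate t"] assms(1-5)
    by (simp_all add: d_def n_def att_eq_A)
  have "(28/100) / n * (w * Var (\<Theta> t)) = 2 / n * (14/100 * w * Var (\<Theta> t))"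
    by simp
  also have "\<dots> \<le> 2 / n * d"
    using d \<open>n > 0\<close> by (intro mult_left_mono) auto
  finally have "c * x \<le> 2 / n * d"
    using c by (simp add: n_def)
  moreover have "2 / n * d \<le> 2 / n * (3 * w * n * Var (\<Theta> t))"
    using d \<open>n > 0\<close> by (intro mult_left_mono) auto
  then have "2 / n * d \<le> C * x"
    using C \<open>n > 0\<close> by (simp add: mult.assoc)
  ultimately show ?thesis
    unfolding Var_decay_def
    using deriv_Var[OF assms(1,2)] by (intro exI conjI) (auto simp: d_def n_def)
qed

text \<open>A rate of order \<open>1/t\<close> is not integrable, so the smallest inner product stays above
  the barrier \<open>1 - 2 (t/T)\<^sup>-\<^sup>c\<close> and tends to 1.\<close>

lemma eventually_in_cone:
  assumes "T > 0" "\<kappa> > 0" "\<eta> > 0"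
    and no_switch: "\<And>t. t > T \<Longrightarrow> t \<notin> switching_times S"
    and rate: "\<And>t j. t > T \<Longrightarrow> rate t j \<ge> \<kappa> / t"
  shows "\<forall>\<^sub>F t in at_top. in_cone \<eta> (\<Theta> t)"
proof -
  define n where "n = real CARD('n)"
  have "n > 0" by (simp add: n_def)
  \<comment> \<open>Each token of a touching pair contributes at least (\<kappa>/t) * 1/(2n) * g =
    (c/t) g. Together they give twice the decay rate of the barrier, hence a strictly positive
    derivative.\<close>
  define c where "c = \<kappa> / (2 * n)"
  have "c > 0" using assms \<open>n > 0\<close> by (simp add: c_def)
  \<comment> \<open>The factor 2 puts the level at -1 when t = T, below the inner products, which
    are positive there.\<close>
  define g where "g t = 2 * (t / T) powr (- c)" for t
  define f where "f p t = \<Theta> t (fst p) \<bullet> \<Theta> t (snd p) + (g t - 1)" for p t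
  have g_deriv: "(g has_real_derivative - (c / t * g t)) (at t)" if "t > 0" for t
    unfolding g_def using that \<open>T > 0\<close>
    by (auto intro!: derivative_eq_intros simp: powr_diff field_simps)
  have bound: "\<Theta> b i \<bullet> \<Theta> b j \<ge> 1 - g b" if "b \<ge> T" for b i j
  proof -
    have "f (i, j) b \<ge> 0"
    proof (rule finite_barrier[where f = f and a = T and b = b])
      show "continuous_on {T..b} (f p)" for p
        unfolding f_def g_def using \<open>T > 0\<close>
        by (intro continuous_intros cont_inner) auto
      show "f p T > 0" for p
        using inner_pos[of T "fst p" "snd p"] \<open>T > 0\<close> by (simp add: f_def g_def)
      fix t p assume t: "T < t" "t < b" and f: "\<forall>q. f q t \<ge> 0" "f p t = 0"
      obtain k l where p: "p = (k, l)" by fastforce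
      have "t > 0" "t \<notin> switching_times S" using t assms(1) no_switch by auto
      have m: "\<Theta> t k \<bullet> \<Theta> t l = 1 - g t"
        using f(2) by (simp add: f_def p)
      have min: "\<Theta> t k \<bullet> \<Theta> t l \<le> \<Theta> t k' \<bullet> \<Theta> t l'" for k' l'
        using f(1)[rule_format, of "(k', l')"] f(2) by (simp add: f_def p)
      have g: "g t > 0" "g t \<le> 1"
        using inner_pos[of t k l] \<open>t > 0\<close> \<open>T > 0\<close> m by (auto simp: g_def)
      have "rate t i * drift t i j \<ge> c / t * g t"
        if ij: "(i, j) = (k, l) \<or> (i, j) = (l, k)" for i j
      proof -
        have m': "\<Theta> t i \<bullet> \<Theta> t j = 1 - g t"
          using ij m by (auto simp: inner_commute)
        \<comment> \<open>For 0 < g \<le> 1 one has 1 - (1 - g)^2 = 2 g - g^2 \<ge> g.\<close>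
        have "1 / (2 * n) * g t \<le> attn_weight \<beta> Q K (\<Theta> t) i j * (1 - (1 - g t)\<^sup>2)"
        proof (intro mult_mono)
          show "1 / (2 * n) \<le> attn_weight \<beta> Q K (\<Theta> t) i j"
            using near_uniform_attention.weight_lower[OF near_uniform[of t]] \<open>t > 0\<close>
            by (simp add: n_def)
          have "g t * g t \<le> g t * 1" using g by (intro mult_left_mono) auto
          then show "g t \<le> 1 - (1 - g t)\<^sup>2" by (simp add: power2_eq_square algebra_simps)
        qed (use g attn_weight_nonneg in auto)
        also have "\<dots> \<le> drift t i j"
          using drift_lower[of t i j, unfolded m'] min[unfolded m] g \<open>t > 0\<close> by simp
        finally have "\<kappa> / t * (1 / (2 * n) * g t) \<le> rate t i * drift t i j"
          using rate[of t i] rate_nonneg[of t i] t \<open>t > 0\<close> \<open>\<kappa> > 0\<close> g \<open>n > 0\<close>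
          by (intro mult_mono) auto
        then show ?thesis by (simp add: c_def mult_ac)
      qed
      then have "rate t k * drift t k l \<ge> c / t * g t" "rate t l * drift t l k \<ge> c / t * g t"
        by auto
      moreover have "c / t * g t > 0"
        using \<open>c > 0\<close> \<open>t > 0\<close> g by simp
      ultimately have
        "rate t k * drift t k l + rate t l * drift t l k + - (c / t * g t) > 0"
        by linarith
      moreover have "(f p has_real_derivative
          rate t k * drift t k l + rate t l * drift t l k + - (c / t * g t)) (at t)"
        unfolding f_def p fst_conv snd_conv
        using g_deriv[OF \<open>t > 0\<close>]
        by (intro DERIV_add[OF deriv_inner[OF \<open>t > 0\<close> \<open>t \<notin> _\<close>]])
          (auto intro!: derivative_eq_intros)
      ultimately show "\<exists>D>0. (f p has_real_derivative D) (at t)" by blast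
    qed (use that in auto)
    then show ?thesis by (simp add: f_def)
  qed
  have "filterlim (\<lambda>t. t / T) at_top at_top"
    using \<open>T > 0\<close> filterlim_tendsto_pos_mult_at_top[of "\<lambda>_. 1 / T" "1 / T" at_top "\<lambda>t. t"]
    by (simp add: filterlim_ident)
  then have "((\<lambda>t. (t / T) powr (- c)) \<longlongrightarrow> 0) at_top"
    using \<open>c > 0\<close> by (intro tendsto_neg_powr) auto
  then have "(g \<longlongrightarrow> 0) at_top"
    unfolding g_def by (intro tendsto_mult_right_zero)
  then have "\<forall>\<^sub>F t in at_top. g t < \<eta>"
    using \<open>\<eta> > 0\<close> by (rule order_tendstoD)
  then show ?thesis
    using eventually_ge_at_top[of T]
  proof eventually_elim
    case (elim t)
    show ?case
      unfolding in_cone_def using bound[of t] elim by (smt (verit))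
  qed
qed

end

section \<open>Schemes with radial growth\<close>

text \<open>The common features of Pre-LN, Peri-LN and, after the switching time, Mix-LN.\<close>

locale radial_attention_flow = cone_attention_flow \<beta> \<delta> Q K S \<Theta> r
  for \<beta> \<delta> :: real and Q K :: "real^'d^'d" and S :: scheme
    and \<Theta> :: "real \<Rightarrow> 'n::finite \<Rightarrow> real^'d" and r :: "real \<Rightarrow> 'n \<Rightarrow> real" +
  fixes T\<^sub>0 :: real
  assumes T\<^sub>0: "T\<^sub>0 \<ge> 0"
    and no_switch: "\<And>t. t > T\<^sub>0 \<Longrightarrow> t \<notin> switching_times S"
    and radial: "\<And>t \<theta> (A :: real^'d). t > T\<^sub>0 \<Longrightarrow> norm \<theta> = 1 \<Longrightarrow> norm A \<le> 1 \<Longrightarrow> \<theta> \<bullet> A > 0 \<Longrightarrow>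
        \<theta> \<bullet> A \<le> radial_rate S t \<theta> A \<and> radial_rate S t \<theta> A \<le> 1"
    and speed: "\<And>t \<theta> (A :: real^'d) x. t > T\<^sub>0 \<Longrightarrow> norm \<theta> = 1 \<Longrightarrow> norm A \<le> 1 \<Longrightarrow> \<theta> \<bullet> A > 0 \<Longrightarrow>
        x \<ge> 0 \<Longrightarrow> x * (\<theta> \<bullet> A) \<le> speed S t x A \<and> speed S t x A \<le> x"
begin

lemma inner_att_pos: "t \<ge> 0 \<Longrightarrow> \<Theta> t j \<bullet> att t j > 0"
  using inner_att_ge[OF in_cone, of t j] \<delta>_less_1 by simp

lemma radial_bounds:
  assumes "t > T\<^sub>0"
  shows "\<Theta> t j \<bullet> att t j \<le> radial_rate S t (\<Theta> t j) (att t j)"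
    and "radial_rate S t (\<Theta> t j) (att t j) \<le> 1"
  using radial[OF assms unit norm_att_le inner_att_pos] assms T\<^sub>0 by auto

lemma speed_bounds:
  assumes "t > T\<^sub>0"
  shows "r t j * (\<Theta> t j \<bullet> att t j) \<le> speed S t (r t j) (att t j)"
    and "speed S t (r t j) (att t j) \<le> r t j"
  using speed[OF assms unit norm_att_le inner_att_pos r_nonneg] assms T\<^sub>0 by auto

text \<open>The radial rate lies between \<theta>_j \<bullet> A_j and 1, and in the cone the former
  is at least 1 - \<eta>.\<close>

lemma radial_growth:
  assumes "a \<ge> T\<^sub>0" "b \<ge> a" and "\<And>t. t > a \<Longrightarrow> in_cone \<eta> (\<Theta> t)"
  shows "(1 - \<eta>) * (b - a) \<le> r b j - r a j" "r b j - r a j \<le> b - a"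
proof -
  have cont: "continuous_on {a..b} (\<lambda>t. r t j)"
    using assms T\<^sub>0 by (intro continuous_on_subset[OF cont_r]) auto
  have deriv: "\<exists>D. ((\<lambda>t. r t j) has_real_derivative D) (at t) \<and> 1 - \<eta> \<le> D \<and> D \<le> 1"
    if "a < t" "t < b" for t
    using deriv_r[of t j] no_switch[of t] radial_bounds[of t j] inner_att_ge[OF assms(3), of t j]
      that assms T\<^sub>0 by (intro exI conjI) auto
  show "(1 - \<eta>) * (b - a) \<le> r b j - r a j" "r b j - r a j \<le> b - a"
    using increment_bounds[OF cont \<open>b \<ge> a\<close> deriv] by auto
qed

lemma radial_growth_cone: "b \<ge> T\<^sub>0 \<Longrightarrow> r b j \<ge> (1 - \<delta>) * (b - T\<^sub>0)"
  using radial_growth(1)[of T\<^sub>0 b \<delta> j] in_cone r_nonneg[of T\<^sub>0 j] T\<^sub>0 by fastforce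

lemma clustering: "\<eta> > 0 \<Longrightarrow> \<forall>\<^sub>F t in at_top. in_cone \<eta> (\<Theta> t)"
proof (rule eventually_in_cone[where \<kappa> = "1/2"])
  \<comment> \<open>Beyond \<open>T\<close> the time exceeds every radius at
    \<open>T\<^sub>0\<close>. Growth at rate at most 1 then gives r \<le> 2 t, whence the choice
    \<kappa> = 1/2.\<close>
  define T where "T = T\<^sub>0 + 1 + (\<Sum>j\<in>UNIV. r T\<^sub>0 j)"
  have sum: "0 \<le> (\<Sum>j\<in>UNIV. r T\<^sub>0 j)" "r T\<^sub>0 j \<le> (\<Sum>j\<in>UNIV. r T\<^sub>0 j)" for j
    using r_nonneg T\<^sub>0 by (auto intro!: sum_nonneg member_le_sum)
  then show "T > 0" using T\<^sub>0 by (simp add: T_def)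
  show "t \<notin> switching_times S" if "t > T" for t
    using that sum by (intro no_switch) (simp add: T_def)
  fix t j assume "t > T"
  then have t: "t > T\<^sub>0" "t > r T\<^sub>0 j" "t > 0"
    using sum(1) sum(2)[of j] T\<^sub>0 by (auto simp: T_def)
  have "r t j \<le> 2 * t"
    using radial_growth(2)[of T\<^sub>0 t \<delta> j] in_cone t T\<^sub>0 by simp
  \<comment> \<open>A lower bound on the rate needs a positive speed, because division by a zero
    speed would return 0.\<close>
  moreover have "(1 - \<delta>) * (t - T\<^sub>0) > 0"
    using t \<delta>_less_1 by simp
  then have "r t j > 0"
    using radial_growth_cone[of t j] t by simp
  then have "r t j * (\<Theta> t j \<bullet> att t j) > 0"
    using inner_att_pos[of t j] t by simp
  ultimately show "rate t j \<ge> (1/2) / t"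
    using speed_bounds[of t j] t by (simp add: rate_def field_simps)
qed simp

text \<open>Once clustering makes the speeds comparable with t and with each other,
  \<open>dissipation\<close> applies. The starting time depends on the solution, the constants do
  not.\<close>

lemma eventually_Var_decay:
  "\<forall>\<^sub>F t in at_top. Var_decay (1 / (4 * real CARD('n))) 6 \<Theta> t (Var (\<Theta> t) / t)"
proof -
  obtain T\<^sub>1 where T\<^sub>1: "\<And>t. t \<ge> T\<^sub>1 \<Longrightarrow> in_cone (1/10) (\<Theta> t)"
    using clustering[of "1/10"] by (auto simp: eventually_at_top_linorder)
  define T where "T = max T\<^sub>0 T\<^sub>1"
  define R where "R = (\<Sum>j\<in>UNIV. r T j)"
  have T: "T \<ge> T\<^sub>0" "T \<ge> 0" using T\<^sub>0 by (auto simp: T_def)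
  have R: "0 \<le> R" "r T j \<le> R" for j
    using r_nonneg T by (auto simp: R_def intro!: sum_nonneg member_le_sum)
  show ?thesis
    \<comment> \<open>Then T and R are each below t/10, so r \<ge> 0.9 (t - T) \<ge> 0.8 t and r
      \<le> R + t \<le> 1.1 t.\<close>
    using eventually_gt_at_top[of "10 * T + 10 * R"]
  proof eventually_elim
    case (elim t)
    have t: "t > T" "t > 0" using elim T R by auto
    have bounds: "(8/10) * t \<le> r t j" "r t j \<le> (11/10) * t" for j
      using radial_growth[of T t "1/10" j] T\<^sub>1 T elim t R(2)[of j] R(1) r_nonneg[of T j]
      by (auto simp: T_def)
    have speeds: "(72/100) * t \<le> speed S t (r t j) (att t j)"
      "speed S t (r t j) (att t j) \<le> (11/10) * t" for j
    proof -
      have "(8/10) * t * (1 - 1/10) \<le> r t j * (\<Theta> t j \<bullet> att t j)"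
        using bounds[of j] t inner_att_ge[OF T\<^sub>1, of t j] by (intro mult_mono) (auto simp: T_def)
      then show "(72/100) * t \<le> speed S t (r t j) (att t j)"
        "speed S t (r t j) (att t j) \<le> (11/10) * t"
        using speed_bounds[of t j] bounds[of j] t T by auto
    qed
    show ?case
    \<comment> \<open>The weight is the reciprocal of the largest speed 1.1 t. The factor two holds
      because 1/0.72 < 20/11, and 0.28 * 10/11 exceeds 1/4.\<close>
    proof (rule Var_decay_of_rates[where w = "(10/11) / t"])
      fix j
      have s: "speed S t (r t j) (att t j) > 0"
        using speeds(1)[of j] t by simp
      show "(10/11) / t \<le> rate t j" "rate t j \<le> 2 * ((10/11) / t)"
        using speeds[of j] s t by (simp_all add: rate_def field_simps)
    next
      show "t \<notin> switching_times S" using t T by (intro no_switch) auto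
      have x: "Var (\<Theta> t) / t \<ge> 0" using Var_nonneg[of "\<Theta> t"] t by simp
      have "1 / (4 * real CARD('n)) * (Var (\<Theta> t) / t)
          \<le> ((28/100) * (10/11)) / real CARD('n) * (Var (\<Theta> t) / t)"
        by (intro mult_right_mono x) (simp add: field_simps)
      then show "1 / (4 * real CARD('n)) * (Var (\<Theta> t) / t)
          \<le> (28/100) / real CARD('n) * ((10/11) / t * Var (\<Theta> t))"
        by simp
      show "6 * ((10/11) / t * Var (\<Theta> t)) \<le> 6 * (Var (\<Theta> t) / t)"
        using x by simp
    qed (use t in auto)
  qed
qed

end

section \<open>Schemes with explicit speeds\<close>

context cone_attention_flow
begin

text \<open>The rates are \<alpha>_t / norm A_j, and the norms are comparable with \<rho>, which
  lies in [1/n, 1]. The natural order is therefore \<alpha>_t Var, and 1/n accounts for the n in the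
  upper constant.\<close>

lemma Var_decay_NGPT:
  assumes S: "S = NGPT \<alpha>" and "t > 0" "\<alpha> t > 0"
  shows "Var_decay (1 / (5 * real CARD('n))) (6 * real CARD('n)) \<Theta> t (\<alpha> t * Var (\<Theta> t))"
proof -
  define n where "n = real CARD('n)"
  define \<rho> where "\<rho> = norm (center (\<Theta> t))"
  have n: "n \<ge> 1" by (simp add: n_def Suc_leI)
  have \<rho>: "1 / n \<le> \<rho>" "\<rho> \<le> 1"
    using near_uniform_attention.center_ge[OF near_uniform[of t]]
      near_uniform_attention.center_le[OF near_uniform[of t]] \<open>t > 0\<close>
    by (auto simp: \<rho>_def n_def)
  moreover have "1 / n > 0" using n by simp
  ultimately have "\<rho> > 0" by linarith
  have A: "82/100 * \<rho> \<le> norm (att t j)" "norm (att t j) \<le> 118/100 * \<rho>" for j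
    using near_uniform_attention.norm_A_bounds[OF near_uniform[of t], of j] \<open>t > 0\<close>
    by (auto simp: \<rho>_def att_eq_A)
  define w where "w = \<alpha> t / (118/100 * \<rho>)"
  have rate: "rate t j = \<alpha> t / norm (att t j)" for j
    unfolding rate_def by (simp add: S field_simps)
  have v: "\<alpha> t * Var (\<Theta> t) \<ge> 0" using Var_nonneg[of "\<Theta> t"] assms by simp
  show ?thesis
  proof (rule Var_decay_of_rates[where w = w])
    fix j
    have "norm (att t j) > 0" using A(1)[of j] \<open>\<rho> > 0\<close> by linarith
    then show "w \<le> rate t j"
      unfolding w_def rate using A(2)[of j] \<open>\<rho> > 0\<close> assms(3)
      by (intro divide_left_mono mult_pos_pos) auto
    have "rate t j \<le> \<alpha> t / (82/100 * \<rho>)"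
      unfolding rate using A(1)[of j] \<open>\<rho> > 0\<close> assms(3) \<open>norm (att t j) > 0\<close>
      by (intro divide_left_mono mult_pos_pos) auto
    also have "\<dots> \<le> 2 * w"
      using \<open>\<rho> > 0\<close> assms(3) by (simp add: w_def field_simps)
    finally show "rate t j \<le> 2 * w" .
  next
    show "w \<ge> 0" using \<open>\<rho> > 0\<close> assms(3) by (simp add: w_def)
    show "t \<notin> switching_times S" by (simp add: S)
    have "\<alpha> t / (118/100) \<le> w"
      unfolding w_def using \<rho> \<open>\<rho> > 0\<close> assms(3) by (intro divide_left_mono) auto
    then have "(28/100) / n * (\<alpha> t / (118/100) * Var (\<Theta> t)) \<le> (28/100) / n * (w * Var (\<Theta> t))"
      using n by (intro mult_left_mono mult_right_mono Var_nonneg) auto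
    moreover have "1 / (5 * n) * (\<alpha> t * Var (\<Theta> t)) \<le> (28/118) / n * (\<alpha> t * Var (\<Theta> t))"
      using n by (intro mult_right_mono v) (simp add: field_simps)
    ultimately show "1 / (5 * real CARD('n)) * (\<alpha> t * Var (\<Theta> t))
        \<le> (28/100) / real CARD('n) * (w * Var (\<Theta> t))"
      by (simp add: n_def)
    have "w \<le> \<alpha> t / (1 / n)"
      unfolding w_def using \<rho>(1) \<open>\<rho> > 0\<close> assms(3) n
      by (intro divide_left_mono mult_pos_pos) auto
    then have "6 * (w * Var (\<Theta> t)) \<le> 6 * (\<alpha> t / (1 / n) * Var (\<Theta> t))"
      by (intro mult_left_mono mult_right_mono Var_nonneg) auto
    then show "6 * (w * Var (\<Theta> t)) \<le> 6 * real CARD('n) * (\<alpha> t * Var (\<Theta> t))"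
      by (simp add: n_def mult_ac)
  qed fact
qed

lemma Var_decay_Post_LN:
  assumes "S = Post_LN" "t > 0"
  shows "Var_decay (1 / (4 * real CARD('n))) 6 \<Theta> t (Var (\<Theta> t))"
proof (rule Var_decay_of_rates[where w = 1])
  have rate: "rate t j = 1" for j
    unfolding rate_def by (simp add: assms)
  then show "1 \<le> rate t j" "rate t j \<le> 2 * 1" for j by simp_all
  show "1 / (4 * real CARD('n)) * Var (\<Theta> t) \<le> (28/100) / real CARD('n) * (1 * Var (\<Theta> t))"
    unfolding mult_1 by (intro mult_right_mono Var_nonneg) (simp add: field_simps)
qed (use assms in auto)

text \<open>From t = 1 on, sqrt (t + 1) lies between sqrt t and 2 sqrt t. The factor 2 reduces 0.28
  to 0.14, which exceeds 1/8.\<close>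

lemma Var_decay_Sqrt_Scaling:
  assumes S: "S = Sqrt_Scaling" and "t \<ge> 1"
  shows "Var_decay (1 / (8 * real CARD('n))) 6 \<Theta> t (Var (\<Theta> t) / sqrt t)"
proof (rule Var_decay_of_rates[where w = "1 / sqrt (t + 1)"])
  have rate: "rate t j = 1 / sqrt (t + 1)" for j
    unfolding rate_def by (simp add: S)
  then show "1 / sqrt (t + 1) \<le> rate t j" "rate t j \<le> 2 * (1 / sqrt (t + 1))" for j
    using \<open>t \<ge> 1\<close> by (simp_all add: divide_right_mono)
  have "sqrt (t + 1) \<le> sqrt (4 * t)" using \<open>t \<ge> 1\<close> by simp
  then have s: "sqrt t \<le> sqrt (t + 1)" "sqrt (t + 1) \<le> 2 * sqrt t"
    by (simp_all add: real_sqrt_mult)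
  have pos: "sqrt t > 0" using \<open>t \<ge> 1\<close> by simp
  have "1 / (8 * real CARD('n)) * (Var (\<Theta> t) / sqrt t)
      \<le> (28/100) / real CARD('n) * (Var (\<Theta> t) / (2 * sqrt t))"
    using pos Var_nonneg[of "\<Theta> t"] by (simp add: field_simps)
  also have "\<dots> \<le> (28/100) / real CARD('n) * (Var (\<Theta> t) / sqrt (t + 1))"
    using s pos Var_nonneg by (intro mult_left_mono divide_left_mono mult_pos_pos) auto
  finally show "1 / (8 * real CARD('n)) * (Var (\<Theta> t) / sqrt t)
      \<le> (28/100) / real CARD('n) * (1 / sqrt (t + 1) * Var (\<Theta> t))" by simp
  have "Var (\<Theta> t) / sqrt (t + 1) \<le> Var (\<Theta> t) / sqrt t"
    using s pos Var_nonneg by (intro divide_left_mono mult_pos_pos) auto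
  then show "6 * (1 / sqrt (t + 1) * Var (\<Theta> t)) \<le> 6 * (Var (\<Theta> t) / sqrt t)" by simp
qed (use assms in auto)

end

section \<open>Verification of the schemes and choice of uniform constants\<close>

lemma norm_ge_inner_unit: "norm \<theta> = 1 \<Longrightarrow> \<theta> \<bullet> A \<le> norm (A :: 'a::real_inner)"
  using norm_cauchy_schwarz[of \<theta> A] by simp

theorem theorem4p3:
  fixes \<beta> \<delta> :: real and Q K :: "real^'d^'d"
  assumes "\<beta> > 0"
    and "onorm (\<lambda>x. (transpose Q ** K) *v x) \<le> 1"
    and "\<delta> < 1 / (100 * (real CARD('n::finite))\<^sup>2 * \<beta>\<^sup>2)"
    and "\<delta> < 1"
  shows
    "(\<forall>S\<in>{Pre_LN, Peri_LN}. \<forall>(\<Theta> :: real \<Rightarrow> 'n \<Rightarrow> real^'d) r. cone_flow \<beta> Q K \<delta> S \<Theta> r \<longrightarrow>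
        (\<forall>k. \<forall>t\<ge>0. r t k \<ge> (1 - \<delta>) * t)) \<and>
     (\<exists>c>0. \<exists>C>0. \<forall>(\<Theta> :: real \<Rightarrow> 'n \<Rightarrow> real^'d) r. cone_flow \<beta> Q K \<delta> Post_LN \<Theta> r \<longrightarrow>
        (\<forall>t>0. Var_decay c C \<Theta> t (Var (\<Theta> t)))) \<and>
     (\<exists>c>0. \<exists>C>0. \<forall>(\<Theta> :: real \<Rightarrow> 'n \<Rightarrow> real^'d) r. cone_flow \<beta> Q K \<delta> Pre_LN \<Theta> r \<longrightarrow>
        (\<forall>\<^sub>F t in at_top. Var_decay c C \<Theta> t (Var (\<Theta> t) / t))) \<and>
     (\<exists>c>0. \<exists>C>0. \<forall>(\<Theta> :: real \<Rightarrow> 'n \<Rightarrow> real^'d) r. cone_flow \<beta> Q K \<delta> Peri_LN \<Theta> r \<longrightarrow>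
        (\<forall>\<^sub>F t in at_top. Var_decay c C \<Theta> t (Var (\<Theta> t) / t))) \<and>
     ((\<forall>a>0. \<forall>b>0. \<exists>c>0. \<exists>C>0. \<forall>\<alpha> (\<Theta> :: real \<Rightarrow> 'n \<Rightarrow> real^'d) r.
          (\<forall>t>0. a \<le> \<alpha> t \<and> \<alpha> t \<le> b) \<and> cone_flow \<beta> Q K \<delta> (NGPT \<alpha>) \<Theta> r \<longrightarrow>
          (\<forall>t>0. Var_decay c C \<Theta> t (Var (\<Theta> t) / \<alpha> t))) \<and>
      (\<exists>c>0. \<exists>C>0. \<forall>\<alpha> (\<Theta> :: real \<Rightarrow> 'n \<Rightarrow> real^'d) r.
          (\<forall>t>0. \<alpha> t > 0) \<and> cone_flow \<beta> Q K \<delta> (NGPT \<alpha>) \<Theta> r \<longrightarrow>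
          (\<forall>t>0. Var_decay c C \<Theta> t (\<alpha> t * Var (\<Theta> t))))) \<and>
     (\<exists>c>0. \<exists>C>0. \<forall>\<tau> (\<Theta> :: real \<Rightarrow> 'n \<Rightarrow> real^'d) r. cone_flow \<beta> Q K \<delta> (Mix_LN \<tau>) \<Theta> r \<longrightarrow>
        (\<forall>\<^sub>F t in at_top. Var_decay c C \<Theta> t (Var (\<Theta> t) / t))) \<and>
     (\<exists>c>0. \<exists>C>0. \<forall>(\<Theta> :: real \<Rightarrow> 'n \<Rightarrow> real^'d) r. cone_flow \<beta> Q K \<delta> Sqrt_Scaling \<Theta> r \<longrightarrow>
        (\<forall>t\<ge>1. Var_decay c C \<Theta> t (Var (\<Theta> t) / sqrt t)))"
proof -
  define n where "n = real CARD('n)"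
  have n: "n > 0" by (simp add: n_def)
  have ex2I: "\<exists>c>0. \<exists>C>0. P c C" if "c > 0" "C > 0" "P c C" for P and c C :: real
    by (rule exI[of _ c], rule conjI, rule that(1), rule exI[of _ C], rule conjI, rule that(2), rule that(3))
  have flowI: "cone_attention_flow \<beta> \<delta> Q K S \<Theta> r"
    if "cone_flow \<beta> Q K \<delta> S \<Theta> r"
      "\<And>t x (A :: real^'d). t > 0 \<Longrightarrow> x \<ge> 0 \<Longrightarrow> speed S t x A \<ge> 0"
    for S and \<Theta> :: "real \<Rightarrow> 'n \<Rightarrow> real^'d" and r
    using assms that by unfold_locales
  have le_1: "\<theta> \<bullet> A \<le> 1" if "norm \<theta> = 1" "norm A \<le> 1" for \<theta> A :: "real^'d"
    using norm_ge_inner_unit[of \<theta> A] that by simp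
  have pre: "radial_attention_flow \<beta> \<delta> Q K Pre_LN \<Theta> r 0"
    if "cone_flow \<beta> Q K \<delta> Pre_LN \<Theta> r" for \<Theta> :: "real \<Rightarrow> 'n \<Rightarrow> real^'d" and r
    by (intro radial_attention_flow.intro radial_attention_flow_axioms.intro flowI that)
      (auto intro!: mult_left_le le_1)
  have peri: "radial_attention_flow \<beta> \<delta> Q K Peri_LN \<Theta> r 0"
    if "cone_flow \<beta> Q K \<delta> Peri_LN \<Theta> r" for \<Theta> :: "real \<Rightarrow> 'n \<Rightarrow> real^'d" and r
  proof (intro radial_attention_flow.intro radial_attention_flow_axioms.intro flowI that)
    fix t x :: real and \<theta> A :: "real^'d"
    assume A: "norm \<theta> = 1" "norm A \<le> 1" "\<theta> \<bullet> A > 0"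
    then have le: "\<theta> \<bullet> A \<le> norm A" by (simp add: norm_ge_inner_unit)
    then have "norm A > 0" using A by linarith
    \<comment> \<open>Dividing by a norm of at most 1 does not decrease \<theta> \<bullet> A, and
      Cauchy-Schwarz keeps the quotient at most 1.\<close>
    moreover have "(\<theta> \<bullet> A) * norm A \<le> \<theta> \<bullet> A"
      using A by (intro mult_left_le) auto
    ultimately show "\<theta> \<bullet> A \<le> radial_rate Peri_LN t \<theta> A \<and> radial_rate Peri_LN t \<theta> A \<le> 1"
      using le by (simp add: field_simps)
    show "x * (\<theta> \<bullet> A) \<le> speed Peri_LN t x A \<and> speed Peri_LN t x A \<le> x" if "x \<ge> 0"
      using that A le by (simp add: mult_left_mono mult_left_le)
  qed auto
  \<comment> \<open>Radial growth starts at the switching time, or at 0 if that time is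
    negative.\<close>
  have mix: "radial_attention_flow \<beta> \<delta> Q K (Mix_LN \<tau>) \<Theta> r (max \<tau> 0)"
    if "cone_flow \<beta> Q K \<delta> (Mix_LN \<tau>) \<Theta> r" for \<tau> and \<Theta> :: "real \<Rightarrow> 'n \<Rightarrow> real^'d" and r
    by (intro radial_attention_flow.intro radial_attention_flow_axioms.intro flowI that)
      (auto intro!: mult_left_le le_1)
  have ngpt: "cone_attention_flow \<beta> \<delta> Q K (NGPT \<alpha>) \<Theta> r"
    if "cone_flow \<beta> Q K \<delta> (NGPT \<alpha>) \<Theta> r" "\<forall>t>0. \<alpha> t > 0"
    for \<alpha> and \<Theta> :: "real \<Rightarrow> 'n \<Rightarrow> real^'d" and r
    using that by (intro flowI) (auto simp: less_imp_le)
  have growth: "(1 - \<delta>) * t \<le> r t k"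
    if "S \<in> {Pre_LN, Peri_LN}" "cone_flow \<beta> Q K \<delta> S \<Theta> r" "t \<ge> 0"
    for S and \<Theta> :: "real \<Rightarrow> 'n \<Rightarrow> real^'d" and r k t
    using that radial_attention_flow.radial_growth_cone[OF pre, of \<Theta> r t k]
      radial_attention_flow.radial_growth_cone[OF peri, of \<Theta> r t k] by auto
  \<comment> \<open>The parameter \<open>x\<close> is the switching time of Mix-LN and a dummy for
    the other two schemes. The constants are chosen before it.\<close>
  have radial_schemes: "\<exists>c>0. \<exists>C>0. \<forall>x (\<Theta> :: real \<Rightarrow> 'n \<Rightarrow> real^'d) r.
      cone_flow \<beta> Q K \<delta> (S x) \<Theta> r \<longrightarrow>
      (\<forall>\<^sub>F t in at_top. Var_decay c C \<Theta> t (Var (\<Theta> t) / t))"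
    if "\<And>x (\<Theta> :: real \<Rightarrow> 'n \<Rightarrow> real^'d) r. cone_flow \<beta> Q K \<delta> (S x) \<Theta> r \<Longrightarrow>
      radial_attention_flow \<beta> \<delta> Q K (S x) \<Theta> r (T x)"
    for S :: "real \<Rightarrow> scheme" and T
  proof (rule ex2I)
    show "\<forall>x (\<Theta> :: real \<Rightarrow> 'n \<Rightarrow> real^'d) r. cone_flow \<beta> Q K \<delta> (S x) \<Theta> r \<longrightarrow>
        (\<forall>\<^sub>F t in at_top. Var_decay (1 / (4 * n)) 6 \<Theta> t (Var (\<Theta> t) / t))"
      unfolding n_def
      by (intro allI impI) (rule radial_attention_flow.eventually_Var_decay[OF that])
  qed (use n in simp_all)
  have ngpt_decay: "Var_decay (1 / (5 * n)) (6 * n) \<Theta> t (\<alpha> t * Var (\<Theta> t))"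
    if "cone_flow \<beta> Q K \<delta> (NGPT \<alpha>) \<Theta> r" "\<forall>t>0. \<alpha> t > 0" "t > 0"
    for \<alpha> t and \<Theta> :: "real \<Rightarrow> 'n \<Rightarrow> real^'d" and r
    unfolding n_def
    by (rule cone_attention_flow.Var_decay_NGPT[OF ngpt[OF that(1,2)] refl]) (use that in auto)
  \<comment> \<open>Writing \<alpha> Var = \<alpha>^2 (Var / \<alpha>) with \<alpha> in [a, b]
    converts the order \<alpha> Var into Var / \<alpha>, at the cost of the factors a^2 and b^2 in
    the constants.\<close>
  have ngpt_bounded: "Var_decay (1 / (5 * n) * a\<^sup>2) (6 * n * b\<^sup>2) \<Theta> t (Var (\<Theta> t) / \<alpha> t)"
    if "a > 0" "\<forall>t>0. a \<le> \<alpha> t \<and> \<alpha> t \<le> b" "cone_flow \<beta> Q K \<delta> (NGPT \<alpha>) \<Theta> r" "t > 0"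
    for a b \<alpha> t and \<Theta> :: "real \<Rightarrow> 'n \<Rightarrow> real^'d" and r
  proof -
    have "a \<le> \<alpha> t" "\<alpha> t \<le> b" using that by auto
    then have \<alpha>: "\<alpha> t > 0" "a\<^sup>2 \<le> (\<alpha> t)\<^sup>2" "(\<alpha> t)\<^sup>2 \<le> b\<^sup>2"
      using \<open>a > 0\<close> by (auto intro: power_mono)
    have eq: "\<alpha> t * Var (\<Theta> t) = (\<alpha> t)\<^sup>2 * (Var (\<Theta> t) / \<alpha> t)"
      using \<alpha>(1) by (simp add: power2_eq_square)
    have v: "Var (\<Theta> t) / \<alpha> t \<ge> 0" using \<alpha>(1) Var_nonneg[of "\<Theta> t"] by simp
    have "1 / (5 * n) * (a\<^sup>2 * (Var (\<Theta> t) / \<alpha> t)) \<le> 1 / (5 * n) * (\<alpha> t * Var (\<Theta> t))"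
      unfolding eq by (intro mult_left_mono mult_right_mono \<alpha> v) (use n in simp)
    moreover have "6 * n * (\<alpha> t * Var (\<Theta> t)) \<le> 6 * n * (b\<^sup>2 * (Var (\<Theta> t) / \<alpha> t))"
      unfolding eq by (intro mult_left_mono mult_right_mono \<alpha> v) (use n in simp)
    moreover have "\<forall>t>0. \<alpha> t > 0" using that(1,2) by (meson less_le_trans)
    then have "Var_decay (1 / (5 * n)) (6 * n) \<Theta> t (\<alpha> t * Var (\<Theta> t))"
      by (rule ngpt_decay[OF that(3) _ that(4)])
    ultimately show ?thesis
      unfolding Var_decay_def mult.assoc by fastforce
  qed
  show ?thesis
  proof (intro conjI)
    show "\<exists>c>0. \<exists>C>0. \<forall>(\<Theta> :: real \<Rightarrow> 'n \<Rightarrow> real^'d) r. cone_flow \<beta> Q K \<delta> Post_LN \<Theta> r \<longrightarrow>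
        (\<forall>t>0. Var_decay c C \<Theta> t (Var (\<Theta> t)))"
    proof (rule ex2I)
      show "\<forall>(\<Theta> :: real \<Rightarrow> 'n \<Rightarrow> real^'d) r. cone_flow \<beta> Q K \<delta> Post_LN \<Theta> r \<longrightarrow>
          (\<forall>t>0. Var_decay (1 / (4 * n)) 6 \<Theta> t (Var (\<Theta> t)))"
        unfolding n_def
        by (intro allI impI) (rule cone_attention_flow.Var_decay_Post_LN[OF flowI], auto)
    qed (use n in simp_all)
    show "\<exists>c>0. \<exists>C>0. \<forall>(\<Theta> :: real \<Rightarrow> 'n \<Rightarrow> real^'d) r. cone_flow \<beta> Q K \<delta> Sqrt_Scaling \<Theta> r \<longrightarrow>
        (\<forall>t\<ge>1. Var_decay c C \<Theta> t (Var (\<Theta> t) / sqrt t))"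
    proof (rule ex2I)
      show "\<forall>(\<Theta> :: real \<Rightarrow> 'n \<Rightarrow> real^'d) r. cone_flow \<beta> Q K \<delta> Sqrt_Scaling \<Theta> r \<longrightarrow>
          (\<forall>t\<ge>1. Var_decay (1 / (8 * n)) 6 \<Theta> t (Var (\<Theta> t) / sqrt t))"
        unfolding n_def
        by (intro allI impI) (rule cone_attention_flow.Var_decay_Sqrt_Scaling[OF flowI], auto)
    qed (use n in simp_all)
    show "\<exists>c>0. \<exists>C>0. \<forall>\<alpha> (\<Theta> :: real \<Rightarrow> 'n \<Rightarrow> real^'d) r.
          (\<forall>t>0. \<alpha> t > 0) \<and> cone_flow \<beta> Q K \<delta> (NGPT \<alpha>) \<Theta> r \<longrightarrow>
          (\<forall>t>0. Var_decay c C \<Theta> t (\<alpha> t * Var (\<Theta> t)))"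
    proof (rule ex2I)
      show "\<forall>\<alpha> (\<Theta> :: real \<Rightarrow> 'n \<Rightarrow> real^'d) r.
          (\<forall>t>0. \<alpha> t > 0) \<and> cone_flow \<beta> Q K \<delta> (NGPT \<alpha>) \<Theta> r \<longrightarrow>
          (\<forall>t>0. Var_decay (1 / (5 * n)) (6 * n) \<Theta> t (\<alpha> t * Var (\<Theta> t)))"
        using ngpt_decay by blast
    qed (use n in simp_all)
    show "\<forall>a>0. \<forall>b>0. \<exists>c>0. \<exists>C>0. \<forall>\<alpha> (\<Theta> :: real \<Rightarrow> 'n \<Rightarrow> real^'d) r.
          (\<forall>t>0. a \<le> \<alpha> t \<and> \<alpha> t \<le> b) \<and> cone_flow \<beta> Q K \<delta> (NGPT \<alpha>) \<Theta> r \<longrightarrow>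
          (\<forall>t>0. Var_decay c C \<Theta> t (Var (\<Theta> t) / \<alpha> t))"
    proof (intro allI impI)
      fix a b :: real
      assume "a > 0" "b > 0"
      show "\<exists>c>0. \<exists>C>0. \<forall>\<alpha> (\<Theta> :: real \<Rightarrow> 'n \<Rightarrow> real^'d) r.
          (\<forall>t>0. a \<le> \<alpha> t \<and> \<alpha> t \<le> b) \<and> cone_flow \<beta> Q K \<delta> (NGPT \<alpha>) \<Theta> r \<longrightarrow>
          (\<forall>t>0. Var_decay c C \<Theta> t (Var (\<Theta> t) / \<alpha> t))"
      proof (rule ex2I)
        show "\<forall>\<alpha> (\<Theta> :: real \<Rightarrow> 'n \<Rightarrow> real^'d) r.
            (\<forall>t>0. a \<le> \<alpha> t \<and> \<alpha> t \<le> b) \<and> cone_flow \<beta> Q K \<delta> (NGPT \<alpha>) \<Theta> r \<longrightarrow>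
            (\<forall>t>0. Var_decay (1 / (5 * n) * a\<^sup>2) (6 * n * b\<^sup>2) \<Theta> t (Var (\<Theta> t) / \<alpha> t))"
          using ngpt_bounded[OF \<open>a > 0\<close>] by blast
      qed (use n \<open>a > 0\<close> \<open>b > 0\<close> in simp_all)
    qed
    show "\<forall>S\<in>{Pre_LN, Peri_LN}. \<forall>(\<Theta> :: real \<Rightarrow> 'n \<Rightarrow> real^'d) r. cone_flow \<beta> Q K \<delta> S \<Theta> r \<longrightarrow>
        (\<forall>k. \<forall>t\<ge>0. r t k \<ge> (1 - \<delta>) * t)"
      using growth by blast
  qed (use radial_schemes[of "\<lambda>_. Pre_LN" "\<lambda>_. 0", OF pre]
      radial_schemes[of "\<lambda>_. Peri_LN" "\<lambda>_. 0", OF peri] radial_schemes[OF mix] in simp_all)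
qed

end
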